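(* Let $U,X,Y$ be Hilbert spaces and let $S=\begin{bmatrix}A\&B\\ C\&D\end{bmatrix}$ be a scattering passive system node on $(U,X,Y)$, with associated semigroup $\mathbb{T}$. Consider the LQ optimal control problem of minimizing $J(x_0,u)=\int_0^\infty \|u(t)\|_U^2+\|y(t)\|_Y^2\,\mathrm{d}t$ subject to $\begin{bmatrix}\dot x(t)\\ y(t)\end{bmatrix}=S\begin{bmatrix}x(t)\\ u(t)\end{bmatrix}$, $t\ge 0$, $x(0)=x_0$. Then the finite cost condition holds and the optimal cost operator $\Pi$ satisfies $\Pi\le I$. If in addition $S$ is scattering energy preserving and the semigroup $\mathbb{T}$ is strongly stable, then the unique stabilizing optimal control is $u(t)=0$, $t\ge0$, and the optimal cost operator is $\Pi=I$. In addition, it satisfies the operator node Riccati equation for $S$ with $E\&F:D(S)\to U$, $E\&F\begin{bmatrix}x\\ u\end{bmatrix}=\sqrt{2}\,u$.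
   Context: System node: a closed operator $S=\begin{bmatrix}A\&B\\ C\&D\end{bmatrix}:D(S)\subset X\times U\to X\times Y$ ($U,X,Y$ Hilbert spaces) is a system node on $(U,X,Y)$ if: (i) the operator $Ax:=A\&B\begin{bmatrix}x\\ 0\end{bmatrix}$ with $D(A)=\{x\in X: (x,0)^\top\in D(S)\}$ generates a strongly continuous semigroup $\mathbb{T}$ on $X$ ($A$ is the semigroup generator and $\mathbb{T}$ the semigroup associated with $S$); (ii) $A\&B$ extends to an operator $[A,\ B]\in\mathcal{L}(X\times U,X_{-1})$, where $X_{-1}$ is the completion of $X$ in the norm $\|(\lambda_0-A)^{-1}\cdot\|_X$ for a fixed $\lambda_0\in\rho(A)$, and $A$ also denotes its extension in $\mathcal{L}(X,X_{-1})$; (iii) $D(S)=\{(x,u)^\top\in X\times U: Ax+Bu\in X\}$. Solutions: $(x,u,y)$ is a classical solution on $[0,\infty)$ if $x\in C^1([0,\infty);X)$, $u\in C([0,\infty);U)$, $y\in C([0,\infty);Y)$, $(x(t),u(t))^\top\in D(S)$ and $(\dot x(t),y(t))^\top=S(x(t),u(t))^\top$ for all $t\ge0$. $(x,u,y)$ is a generalized solution if $x\in C([0,\infty);X)$, $u\in L^2_{\mathrm{loc}}(0,\infty;U)$, $y\in L^2_{\mathrm{loc}}(0,\infty;Y)$ and there are classical solutions $(x_k,u_k,y_k)$ with $x_k\to x$ in $C([0,\infty);X)$ (uniformly on bounded intervals) and $u_k\to u$, $y_k\to y$ in $L^2$ on every interval $[0,\tau]$. The cost $J(x_0,u)$ is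 evaluated along generalized solutions with $x(0)=x_0$. Scattering passive: $2\,\mathrm{Re}\,\langle A\&B\begin{bmatrix}x\\ u\end{bmatrix},x\rangle_X\le \|u\|_U^2-\|C\&D\begin{bmatrix}x\\ u\end{bmatrix}\|_Y^2$ for all $(x,u)^\top\in D(S)$; scattering energy preserving: equality holds for all $(x,u)^\top\in D(S)$. A semigroup $\mathbb{T}$ is strongly stable if $\|\mathbb{T}_tx_0\|\to0$ as $t\to\infty$ for every $x_0\in X$. Finite cost condition: for every $x_0\in X$ there is at least one input $u$ with $J(x_0,u)<\infty$. Optimal cost operator: the operator $\Pi=\Pi^*\in\mathcal{L}(X)$ with $\langle x_0,\Pi x_0\rangle_X=\inf_{u\in L^2(0,\infty;U)}J(x_0,u)$ for all $x_0\in X$; $\Pi\le I$ means $\langle x_0,\Pi x_0\rangle_X\le\|x_0\|_X^2$ for all $x_0\in X$. A control is stabilizing if the corresponding state trajectory satisfies $\lim_{t\to\infty}\|x(t)\|_X=0$. Operator node Riccati equation for $S$ (unknowns $\Pi=\Pi^*\in\mathcal{L}(X)$ and $E\&F:D(S)\to U$): for all $(x,u)^\top\in D(S)$, $\langle A\&B\begin{bmatrix}x\\ u\end{bmatrix},\Pi x\rangle_X+\langle \Pi x,A\&B\begin{bmatrix}x\\ u\end{bmatrix}\rangle_X+\|C\&D\begin{bmatrix}x\\ u\end{bmatrix}\|_Y^2+\|u\|_U^2=\|E\&F\begin{bmatrix}x\\ u\end{bmatrix}\|_U^2$. *)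

theory Defs
  imports "HOL-Analysis.Analysis"
begin

section \<open>Complex Banach and Hilbert spaces\<close>

class complex_banach = banach +
  fixes scaleC :: "complex \<Rightarrow> 'a \<Rightarrow> 'a" (infixr "*\<^sub>C" 75)
  assumes scaleC_add_right: "c *\<^sub>C (x + y) = c *\<^sub>C x + c *\<^sub>C y"
    and scaleC_add_left: "(c + d) *\<^sub>C x = c *\<^sub>C x + d *\<^sub>C x"
    and scaleC_scaleC: "c *\<^sub>C d *\<^sub>C x = (c * d) *\<^sub>C x"
    and scaleC_of_real: "complex_of_real r *\<^sub>C x = r *\<^sub>R x"
    and norm_scaleC: "norm (c *\<^sub>C x) = cmod c * norm x"

text \<open>The complex inner product is antilinear in its first argument. The real inner product (and
  hence the norm) of the underlying real Hilbert space is its real part.\<close>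

class complex_hilbert = complex_banach + real_inner +
  fixes cinner :: "'a \<Rightarrow> 'a \<Rightarrow> complex"
  assumes cinner_commute: "cinner x y = cnj (cinner y x)"
    and cinner_add_right: "cinner x (y + z) = cinner x y + cinner x z"
    and cinner_scaleC_right: "cinner x (c *\<^sub>C y) = c * cinner x y"
    and Re_cinner: "Re (cinner x y) = inner x y"

instantiation complex :: complex_hilbert
begin

definition scaleC_complex :: "complex \<Rightarrow> complex \<Rightarrow> complex"
  where "scaleC_complex c x = c * x"

definition cinner_complex :: "complex \<Rightarrow> complex \<Rightarrow> complex"
  where "cinner_complex x y = cnj x * y"

instance
  by standard
    (simp_all add: scaleC_complex_def cinner_complex_def algebra_simps norm_mult
      scaleR_conv_of_real inner_complex_def)

end

instantiation prod :: (complex_banach, complex_banach) complex_banach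
begin

definition scaleC_prod :: "complex \<Rightarrow> 'a \<times> 'b \<Rightarrow> 'a \<times> 'b"
  where "scaleC_prod c z = (c *\<^sub>C fst z, c *\<^sub>C snd z)"

instance
proof
  fix c d :: complex and r :: real and x y :: "'a \<times> 'b"
  show "c *\<^sub>C (x + y) = c *\<^sub>C x + c *\<^sub>C y"
    by (simp add: scaleC_prod_def scaleC_add_right)
  show "(c + d) *\<^sub>C x = c *\<^sub>C x + d *\<^sub>C x"
    by (simp add: scaleC_prod_def scaleC_add_left)
  show "c *\<^sub>C d *\<^sub>C x = (c * d) *\<^sub>C x"
    by (simp add: scaleC_prod_def scaleC_scaleC)
  show "complex_of_real r *\<^sub>C x = r *\<^sub>R x"
    by (simp add: scaleC_prod_def scaleC_of_real scaleR_prod_def)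
  have "(cmod c * norm (fst x))\<^sup>2 + (cmod c * norm (snd x))\<^sup>2
      = (cmod c)\<^sup>2 * ((norm (fst x))\<^sup>2 + (norm (snd x))\<^sup>2)"
    by (simp add: power_mult_distrib distrib_left)
  then show "norm (c *\<^sub>C x) = cmod c * norm x"
    by (simp add: scaleC_prod_def norm_prod_def norm_scaleC real_sqrt_mult)
qed

end


section \<open>Linear operators\<close>

definition csubspace :: "'a::complex_banach set \<Rightarrow> bool" where
  "csubspace D \<longleftrightarrow> subspace D \<and> (\<forall>c. \<forall>x\<in>D. c *\<^sub>C x \<in> D)"

definition clinear_on :: "'a::complex_banach set \<Rightarrow> ('a \<Rightarrow> 'b::complex_banach) \<Rightarrow> bool" where
  "clinear_on D f \<longleftrightarrow> csubspace D \<and> (\<forall>x\<in>D. \<forall>y\<in>D. f (x + y) = f x + f y) \<and>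
     (\<forall>c. \<forall>x\<in>D. f (c *\<^sub>C x) = c *\<^sub>C f x)"

definition bounded_clinear :: "('a::complex_banach \<Rightarrow> 'b::complex_banach) \<Rightarrow> bool" where
  "bounded_clinear f \<longleftrightarrow> bounded_linear f \<and> (\<forall>c x. f (c *\<^sub>C x) = c *\<^sub>C f x)"

text \<open>An unbounded operator is a pair of a domain \<open>D\<close> and a total function \<open>f\<close>, of which only
  the values on \<open>D\<close> matter.\<close>

definition closed_operator :: "'a::complex_banach set \<Rightarrow> ('a \<Rightarrow> 'b::complex_banach) \<Rightarrow> bool" where
  "closed_operator D f \<longleftrightarrow> clinear_on D f \<and> closed {(x, f x) | x. x \<in> D}"

definition selfadjoint :: "('a::complex_hilbert \<Rightarrow> 'a) \<Rightarrow> bool" where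
  "selfadjoint P \<longleftrightarrow> bounded_clinear P \<and> (\<forall>x y. cinner x (P y) = cinner (P x) y)"

definition resolvent :: "'a::complex_banach set \<Rightarrow> ('a \<Rightarrow> 'a) \<Rightarrow> complex \<Rightarrow> 'a \<Rightarrow> 'a" where
  "resolvent DA A l = inv_into DA (\<lambda>x. l *\<^sub>C x - A x)"

definition resolvent_set :: "'a::complex_banach set \<Rightarrow> ('a \<Rightarrow> 'a) \<Rightarrow> complex set" where
  "resolvent_set DA A =
     {l. bij_betw (\<lambda>x. l *\<^sub>C x - A x) DA UNIV \<and> bounded_clinear (resolvent DA A l)}"


section \<open>Strongly continuous semigroups\<close>

definition c0_semigroup :: "(real \<Rightarrow> 'a::complex_banach \<Rightarrow> 'a) \<Rightarrow> bool" where
  "c0_semigroup T \<longleftrightarrow>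
     (\<forall>t\<ge>0. bounded_clinear (T t)) \<and>
     (\<forall>x. T 0 x = x) \<and>
     (\<forall>s\<ge>0. \<forall>t\<ge>0. \<forall>x. T (s + t) x = T s (T t x)) \<and>
     (\<forall>x. ((\<lambda>t. T t x) \<longlongrightarrow> x) (at_right 0))"

definition generates ::
  "'a::complex_banach set \<Rightarrow> ('a \<Rightarrow> 'a) \<Rightarrow> (real \<Rightarrow> 'a \<Rightarrow> 'a) \<Rightarrow> bool" where
  "generates DA A T \<longleftrightarrow> c0_semigroup T \<and>
     DA = {x. \<exists>z. ((\<lambda>h. (T h x - x) /\<^sub>R h) \<longlongrightarrow> z) (at_right 0)} \<and>
     (\<forall>x\<in>DA. ((\<lambda>h. (T h x - x) /\<^sub>R h) \<longlongrightarrow> A x) (at_right 0))"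

definition strongly_stable :: "(real \<Rightarrow> 'a::complex_banach \<Rightarrow> 'a) \<Rightarrow> bool" where
  "strongly_stable T \<longleftrightarrow> (\<forall>x. ((\<lambda>t. norm (T t x)) \<longlongrightarrow> 0) at_top)"


section \<open>System nodes\<close>

text \<open>A completion of the space of \<open>x\<close> in the norm \<open>norm (resolvent DA A l0 x)\<close> is a complex Banach
  space \<open>'w\<close> together with a linear map \<open>j\<close> into it which is isometric for that norm and has
  dense range. Membership in \<open>X\<close> of an element of \<open>'w\<close> means membership in \<open>range j\<close>.\<close>

definition extrapolation_space ::
  "'a::complex_banach set \<Rightarrow> ('a \<Rightarrow> 'a) \<Rightarrow> complex \<Rightarrow> ('a \<Rightarrow> 'w::complex_banach) \<Rightarrow> bool" where
  "extrapolation_space DA A l0 j \<longleftrightarrow> l0 \<in> resolvent_set DA A \<and> clinear_on UNIV j \<and>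
     (\<forall>x. norm (j x) = norm (resolvent DA A l0 x)) \<and> closure (range j) = UNIV"

text \<open>Such a completion can always be realised on the type of the original space.\<close>

lemma extrapolation_space_resolvent:
  assumes "l0 \<in> resolvent_set DA A" and "closure DA = UNIV"
  shows "extrapolation_space DA A l0 (resolvent DA A l0)"
proof -
  have bij: "bij_betw (\<lambda>x. l0 *\<^sub>C x - A x) DA UNIV"
    and bnd: "bounded_clinear (resolvent DA A l0)"
    using assms(1) by (auto simp: resolvent_set_def)
  have "range (resolvent DA A l0) = DA"
    using bij_betw_inv_into[OF bij] by (simp add: resolvent_def bij_betw_def)
  moreover have "clinear_on UNIV (resolvent DA A l0)"
    using bnd by (simp add: bounded_clinear_def clinear_on_def csubspace_def
        bounded_linear.linear linear_add)
  ultimately show ?thesis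
    using assms by (simp add: extrapolation_space_def)
qed

text \<open>In the operator \<open>S\<close> on \<open>D\<close>, \<open>A&B\<close> is \<open>fst \<circ> S\<close> and \<open>C&D\<close> is \<open>snd \<circ> S\<close>.\<close>

definition main_domain :: "('x::complex_hilbert \<times> 'u::complex_hilbert) set \<Rightarrow> 'x set" where
  "main_domain D = {x. (x, 0) \<in> D}"

definition main_operator ::
  "('x::complex_hilbert \<times> 'u::complex_hilbert \<Rightarrow> 'x \<times> 'y::complex_hilbert) \<Rightarrow> 'x \<Rightarrow> 'x" where
  "main_operator S x = fst (S (x, 0))"

definition associated_semigroup ::
  "('x::complex_hilbert \<times> 'u::complex_hilbert) set \<Rightarrow>
   ('x \<times> 'u \<Rightarrow> 'x \<times> 'y::complex_hilbert) \<Rightarrow> (real \<Rightarrow> 'x \<Rightarrow> 'x) \<Rightarrow> bool" where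
  "associated_semigroup D S T \<longleftrightarrow> generates (main_domain D) (main_operator S) T"

text \<open>\<open>Aext\<close> is the extension of the semigroup generator to an operator from \<open>'x\<close> to the
  extrapolation space, and \<open>\<lambda>(x, u). Aext x + B u\<close> the extension of \<open>A&B\<close>.\<close>

definition system_node ::
  "complex \<Rightarrow> ('x::complex_hilbert \<Rightarrow> 'w::complex_banach) \<Rightarrow>
   ('x \<times> 'u::complex_hilbert) set \<Rightarrow> ('x \<times> 'u \<Rightarrow> 'x \<times> 'y::complex_hilbert) \<Rightarrow> bool" where
  "system_node l0 j D S \<longleftrightarrow>
     closed_operator D S \<and>
     (\<exists>T. associated_semigroup D S T) \<and>
     extrapolation_space (main_domain D) (main_operator S) l0 j \<and>
     (\<exists>Aext B. bounded_clinear Aext \<and> bounded_clinear B \<and>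
        (\<forall>x\<in>main_domain D. Aext x = j (main_operator S x)) \<and>
        (\<forall>(x, u)\<in>D. Aext x + B u = j (fst (S (x, u)))) \<and>
        D = {(x, u). Aext x + B u \<in> range j})"

definition scattering_passive ::
  "('x::complex_hilbert \<times> 'u::complex_hilbert) set \<Rightarrow>
   ('x \<times> 'u \<Rightarrow> 'x \<times> 'y::complex_hilbert) \<Rightarrow> bool" where
  "scattering_passive D S \<longleftrightarrow>
     (\<forall>(x, u)\<in>D. 2 * Re (cinner (fst (S (x, u))) x) \<le> (norm u)\<^sup>2 - (norm (snd (S (x, u))))\<^sup>2)"

definition scattering_energy_preserving ::
  "('x::complex_hilbert \<times> 'u::complex_hilbert) set \<Rightarrow>
   ('x \<times> 'u \<Rightarrow> 'x \<times> 'y::complex_hilbert) \<Rightarrow> bool" where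
  "scattering_energy_preserving D S \<longleftrightarrow>
     (\<forall>(x, u)\<in>D. 2 * Re (cinner (fst (S (x, u))) x) = (norm u)\<^sup>2 - (norm (snd (S (x, u))))\<^sup>2)"


section \<open>Square integrable functions and solutions\<close>

text \<open>The spaces need not be separable, so measurability is Bochner (strong) measurability: almost
  everywhere convergence of a sequence of simple functions. Elements of \<open>L2 I\<close> are functions, not
  classes of functions modulo null sets; only their values on \<open>I\<close> matter.\<close>

definition strongly_measurable_on :: "real set \<Rightarrow> (real \<Rightarrow> 'a::complex_banach) \<Rightarrow> bool" where
  "strongly_measurable_on I f \<longleftrightarrow>
     (\<exists>s. (\<forall>n::nat. simple_function (lebesgue_on I) (s n)) \<and>
        (AE t in lebesgue_on I. (\<lambda>n. s n t) \<longlonglongrightarrow> f t))"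

definition L2 :: "real set \<Rightarrow> (real \<Rightarrow> 'a::complex_banach) set" where
  "L2 I = {f. strongly_measurable_on I f \<and>
     (\<integral>\<^sup>+t. ennreal ((norm (f t))\<^sup>2) \<partial>lebesgue_on I) < \<infinity>}"

definition classical_solution ::
  "('x::complex_hilbert \<times> 'u::complex_hilbert) set \<Rightarrow>
   ('x \<times> 'u \<Rightarrow> 'x \<times> 'y::complex_hilbert) \<Rightarrow>
   (real \<Rightarrow> 'x) \<Rightarrow> (real \<Rightarrow> 'u) \<Rightarrow> (real \<Rightarrow> 'y) \<Rightarrow> bool" where
  "classical_solution D S x u y \<longleftrightarrow>
     continuous_on {0..} u \<and> continuous_on {0..} y \<and>
     (\<exists>x'. continuous_on {0..} x' \<and>
        (\<forall>t\<ge>0. (x has_vector_derivative x' t) (at t within {0..}) \<and>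
           (x t, u t) \<in> D \<and> (x' t, y t) = S (x t, u t)))"

definition generalized_solution ::
  "('x::complex_hilbert \<times> 'u::complex_hilbert) set \<Rightarrow>
   ('x \<times> 'u \<Rightarrow> 'x \<times> 'y::complex_hilbert) \<Rightarrow>
   (real \<Rightarrow> 'x) \<Rightarrow> (real \<Rightarrow> 'u) \<Rightarrow> (real \<Rightarrow> 'y) \<Rightarrow> bool" where
  "generalized_solution D S x u y \<longleftrightarrow>
     continuous_on {0..} x \<and> (\<forall>\<tau>>0. u \<in> L2 {0..\<tau>}) \<and> (\<forall>\<tau>>0. y \<in> L2 {0..\<tau>}) \<and>
     (\<exists>xs us ys. (\<forall>k::nat. classical_solution D S (xs k) (us k) (ys k)) \<and>
        (\<forall>\<tau>>0. uniform_limit {0..\<tau>} xs x sequentially \<and>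
           (\<lambda>k. \<integral>\<^sup>+t. ennreal ((norm (us k t - u t))\<^sup>2) \<partial>lebesgue_on {0..\<tau>}) \<longlonglongrightarrow> 0 \<and>
           (\<lambda>k. \<integral>\<^sup>+t. ennreal ((norm (ys k t - y t))\<^sup>2) \<partial>lebesgue_on {0..\<tau>}) \<longlonglongrightarrow> 0))"


section \<open>The optimal control problem\<close>

text \<open>For a system node and given \<open>x0\<close> and \<open>u\<close> there is at most one generalized solution (with
  \<open>y\<close> determined up to a null set); the infimum only serves to select its cost, and gives the
  value \<open>\<infinity>\<close> if there is no solution.\<close>

definition cost ::
  "('x::complex_hilbert \<times> 'u::complex_hilbert) set \<Rightarrow>
   ('x \<times> 'u \<Rightarrow> 'x \<times> 'y::complex_hilbert) \<Rightarrow> 'x \<Rightarrow> (real \<Rightarrow> 'u) \<Rightarrow> ennreal" where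
  "cost D S x0 u =
     (INF (x, y)\<in>{(x, y). generalized_solution D S x u y \<and> x 0 = x0}.
        \<integral>\<^sup>+t. ennreal ((norm (u t))\<^sup>2 + (norm (y t))\<^sup>2) \<partial>lebesgue_on {0..})"

definition finite_cost_condition ::
  "('x::complex_hilbert \<times> 'u::complex_hilbert) set \<Rightarrow>
   ('x \<times> 'u \<Rightarrow> 'x \<times> 'y::complex_hilbert) \<Rightarrow> bool" where
  "finite_cost_condition D S \<longleftrightarrow> (\<forall>x0. \<exists>u. cost D S x0 u < \<infinity>)"

definition optimal_cost ::
  "('x::complex_hilbert \<times> 'u::complex_hilbert) set \<Rightarrow>
   ('x \<times> 'u \<Rightarrow> 'x \<times> 'y::complex_hilbert) \<Rightarrow> 'x \<Rightarrow> ennreal" where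
  "optimal_cost D S x0 = (INF u\<in>L2 {0..}. cost D S x0 u)"

definition optimal_cost_operator ::
  "('x::complex_hilbert \<times> 'u::complex_hilbert) set \<Rightarrow>
   ('x \<times> 'u \<Rightarrow> 'x \<times> 'y::complex_hilbert) \<Rightarrow> ('x \<Rightarrow> 'x) \<Rightarrow> bool" where
  "optimal_cost_operator D S P \<longleftrightarrow> selfadjoint P \<and>
     (\<forall>x0. optimal_cost D S x0 < \<infinity> \<and>
        cinner x0 (P x0) = complex_of_real (enn2real (optimal_cost D S x0)))"

definition optimal_control ::
  "('x::complex_hilbert \<times> 'u::complex_hilbert) set \<Rightarrow>
   ('x \<times> 'u \<Rightarrow> 'x \<times> 'y::complex_hilbert) \<Rightarrow> 'x \<Rightarrow> (real \<Rightarrow> 'u) \<Rightarrow> bool" where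
  "optimal_control D S x0 u \<longleftrightarrow> u \<in> L2 {0..} \<and> cost D S x0 u = optimal_cost D S x0"

definition stabilizing_control ::
  "('x::complex_hilbert \<times> 'u::complex_hilbert) set \<Rightarrow>
   ('x \<times> 'u \<Rightarrow> 'x \<times> 'y::complex_hilbert) \<Rightarrow> 'x \<Rightarrow> (real \<Rightarrow> 'u) \<Rightarrow> bool" where
  "stabilizing_control D S x0 u \<longleftrightarrow>
     (\<exists>x y. generalized_solution D S x u y \<and> x 0 = x0 \<and> ((\<lambda>t. norm (x t)) \<longlongrightarrow> 0) at_top)"

definition operator_node_riccati ::
  "('x::complex_hilbert \<times> 'u::complex_hilbert) set \<Rightarrow>
   ('x \<times> 'u \<Rightarrow> 'x \<times> 'y::complex_hilbert) \<Rightarrow> ('x \<Rightarrow> 'x) \<Rightarrow> ('x \<times> 'u \<Rightarrow> 'u) \<Rightarrow> bool" where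
  "operator_node_riccati D S P EF \<longleftrightarrow> selfadjoint P \<and> clinear_on D EF \<and>
     (\<forall>(x, u)\<in>D.
        cinner (fst (S (x, u))) (P x) + cinner (P x) (fst (S (x, u)))
          + complex_of_real ((norm (snd (S (x, u))))\<^sup>2) + complex_of_real ((norm u)\<^sup>2)
        = complex_of_real ((norm (EF (x, u)))\<^sup>2))"

end

theory Submission
  imports Defs
begin

text \<open>Along classical solutions passivity reads
  \<open>(d/dt) \<parallel>x\<parallel>\<^sup>2 \<le> \<parallel>u\<parallel>\<^sup>2 - \<parallel>y\<parallel>\<^sup>2\<close>; integrated, and passed to the limit, this bounds
  \<open>\<parallel>x(\<tau>)\<parallel>\<^sup>2 + \<integral>\<parallel>y\<parallel>\<^sup>2\<close> by \<open>\<parallel>x(0)\<parallel>\<^sup>2 + \<integral>\<parallel>u\<parallel>\<^sup>2\<close> for generalized solutions. Hence the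
  semigroup is contractive, \<open>u = 0\<close> produces a generalized solution from every initial state (as a
  limit of orbits in the domain of the generator), and its cost is at most \<open>\<parallel>x\<^sub>0\<parallel>\<^sup>2\<close>. Generalized
  solutions form a linear space, so the optimal cost satisfies the parallelogram law and is the
  quadratic form of a bounded self-adjoint operator; minimizers are not needed for this.
  In the energy preserving case the balance is an equality. The state is the free trajectory, which
  tends to \<open>0\<close>, plus a forced part whose norm at time \<open>\<tau>\<close> is at most the \<open>L\<^sup>2\<close> norm of the input on
  \<open>[0, \<tau>]\<close>, so the output energy is at least \<open>\<parallel>x\<^sub>0\<parallel>\<^sup>2\<close> for every input. Thus the cost exceeds
  \<open>\<parallel>x\<^sub>0\<parallel>\<^sup>2\<close> by at least the energy of the input.\<close>

section \<open>Strongly continuous semigroups\<close>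

text \<open>Two obstacles shape the argument. The output operator is unbounded, so for a general
  initial state the output of the free trajectory exists only as an L2 limit. Values may lie in a
  nonseparable space and measurability is strong measurability, so this limit is built directly, as
  an almost everywhere limit of continuous outputs along initial states that converge geometrically;
  the energy inequality for differences of solutions supplies the Cauchy estimate. In the energy
  preserving case the state under an arbitrary square integrable input is not known beforehand to
  vanish at infinity, so the balance cannot simply be sent to infinite time. The remedy is an exact
  cancellation: the square of the bound on the forced part is the input energy on
  \<open>[0, \<tau>]\<close>, which the balance contains with the opposite sign, and the remaining
  cross term has the decaying free state as a factor. Near-minimizers suffice for the parallelogram
  law because its inequality in one direction, applied once more to the sum and the difference of
  the two states, gives the other direction.\<close>

lemma pointwise_bounded_imp_uniformly_bounded:
  fixes f :: "'i \<Rightarrow> 'a::banach \<Rightarrow> 'b::real_normed_vector"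
  assumes lin: "\<And>i. i \<in> I \<Longrightarrow> bounded_linear (f i)"
    and bnd: "\<And>x. \<exists>M. \<forall>i\<in>I. norm (f i x) \<le> M"
  obtains M where "\<And>i x. i \<in> I \<Longrightarrow> norm (f i x) \<le> M * norm x"
proof -
  \<comment> \<open>Uniform boundedness principle by Baire: these closed sets exhaust the space, so
    one of them contains a ball. Linearity moves the bound on the ball to the origin, as half the
    bound of a difference of two points of the ball, whence the factor \<open>2 / e\<close>.\<close>
  define F where "F n = {x. \<forall>i\<in>I. norm (f i x) \<le> real n}" for n :: nat
  have clF: "closed (F n)" for n
  proof -
    have "F n = (\<Inter>i\<in>I. {x. norm (f i x) \<le> real n})"
      by (auto simp: F_def)
    moreover have "closed {x. norm (f i x) \<le> real n}" if "i \<in> I" for i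
      by (intro closed_Collect_le continuous_intros linear_continuous_on lin that)
    ultimately show ?thesis by auto
  qed
  have "\<Union>(range F) = UNIV"
  proof -
    have "x \<in> \<Union>(range F)" for x
    proof -
      obtain M where M: "\<forall>i\<in>I. norm (f i x) \<le> M" using bnd by blast
      obtain n where "M \<le> real n" using real_arch_simple by blast
      then have "x \<in> F n" using M by (force simp: F_def)
      then show ?thesis by blast
    qed
    then show ?thesis by blast
  qed
  then have "\<exists>n. interior (F n) \<noteq> {}"
    using Baire_category_alt[of "euclidean :: 'a topology" "range F"] clF
      completely_metrizable_space_euclidean
    by (metis closed_closedin countableI_type countable_image empty_not_UNIV euclidean_interior_of
        imageE interior_UNIV)
  then obtain n x0 where "x0 \<in> interior (F n)" by blast
  then obtain e where e: "e > 0" "cball x0 e \<subseteq> F n"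
    by (meson mem_interior_cball)
  have "norm (f i x) \<le> (2 * real n / e) * norm x" if i: "i \<in> I" for i x
  proof (cases "x = 0")
    case True
    then show ?thesis using lin[OF i] by (simp add: linear_simps)
  next
    case False
    define y where "y = x0 + (e / norm x) *\<^sub>R x"
    have "y \<in> F n" "x0 \<in> F n"
      using e False by (auto simp: y_def dist_norm intro!: subsetD[OF e(2)])
    then have b: "norm (f i y) \<le> real n" "norm (f i x0) \<le> real n"
      using i by (auto simp: F_def)
    have "f i x = (norm x / e) *\<^sub>R (f i y - f i x0)"
      using lin[OF i] e False by (simp add: y_def linear_simps)
    then have "norm (f i x) = (norm x / e) * norm (f i y - f i x0)"
      using e by simp
    also have "\<dots> \<le> (norm x / e) * (real n + real n)"
      using b e norm_triangle_ineq4[of "f i y" "f i x0"] by (intro mult_left_mono) auto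
    finally show ?thesis by (simp add: field_simps)
  qed
  then show ?thesis using that by blast
qed

text \<open>Translates between vector derivatives, in which classical solutions are phrased, and the
  difference quotients that define the generator.\<close>

lemma has_vector_derivative_within_iff_quotient:
  "(f has_vector_derivative D) (at t within A)
    \<longleftrightarrow> ((\<lambda>s. (f s - f t) /\<^sub>R (s - t)) \<longlongrightarrow> D) (at t within A)"
proof -
  have "((\<lambda>s. (f s - f t) /\<^sub>R (s - t)) \<longlongrightarrow> D) (at t within A)
      \<longleftrightarrow> ((\<lambda>s. norm ((f s - f t) /\<^sub>R (s - t) - D)) \<longlongrightarrow> 0) (at t within A)"
    by (simp add: tendsto_norm_zero_iff LIM_zero_iff)
  also have "\<dots> \<longleftrightarrow>
      ((\<lambda>s. norm ((f s - (f t + (s - t) *\<^sub>R D)) /\<^sub>R norm (s - t))) \<longlongrightarrow> 0) (at t within A)"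
  proof (intro tendsto_cong, unfold eventually_at_filter, intro always_eventually allI impI)
    fix s assume "s \<noteq> t"
    then have "f s - (f t + (s - t) *\<^sub>R D) = (s - t) *\<^sub>R ((f s - f t) /\<^sub>R (s - t) - D)"
      using scaleR_diff_right[of "s - t" "(f s - f t) /\<^sub>R (s - t)" D] by (simp add: diff_diff_eq)
    then have "norm ((f s - (f t + (s - t) *\<^sub>R D)) /\<^sub>R norm (s - t))
        = norm ((s - t) *\<^sub>R ((f s - f t) /\<^sub>R (s - t) - D)) / \<bar>s - t\<bar>"
      by (simp only: norm_scaleR) (simp add: divide_inverse_commute)
    then show "norm ((f s - f t) /\<^sub>R (s - t) - D)
        = norm ((f s - (f t + (s - t) *\<^sub>R D)) /\<^sub>R norm (s - t))"
      using \<open>s \<noteq> t\<close> by (simp only: norm_scaleR) simp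
  qed
  finally show ?thesis
    unfolding has_vector_derivative_def has_derivative_within
    by (simp only: tendsto_norm_zero_iff) (simp add: bounded_linear_scaleR_left inverse_eq_divide)
qed

lemma tendsto_abs_diff_at_right:
  fixes t :: real
  shows "filterlim (\<lambda>s. \<bar>s - t\<bar>) (at_right 0) (at t within A)"
  unfolding filterlim_at
proof
  show "((\<lambda>s. \<bar>s - t\<bar>) \<longlongrightarrow> 0) (at t within A)"
    by (auto intro!: tendsto_eq_intros)
  show "\<forall>\<^sub>F s in at t within A. \<bar>s - t\<bar> \<in> {0<..} \<and> \<bar>s - t\<bar> \<noteq> 0"
    by (auto simp: eventually_at_filter)
qed

section \<open>Local boundedness, continuity and differentiability of semigroup orbits\<close>

context
  fixes T :: "real \<Rightarrow> 'a::complex_banach \<Rightarrow> 'a"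
  assumes T: "c0_semigroup T"
begin

lemma c0_bounded_linear: "t \<ge> 0 \<Longrightarrow> bounded_linear (T t)"
  using T by (auto simp: c0_semigroup_def bounded_clinear_def)

lemma c0_zero: "T 0 x = x"
  using T by (auto simp: c0_semigroup_def)

lemma c0_add: "s \<ge> 0 \<Longrightarrow> t \<ge> 0 \<Longrightarrow> T (s + t) x = T s (T t x)"
  using T by (auto simp: c0_semigroup_def)

lemma c0_tendsto: "((\<lambda>t. T t x) \<longlongrightarrow> x) (at_right 0)"
  using T by (auto simp: c0_semigroup_def)

text \<open>Strong continuity at 0 controls one vector at a time. If no uniform bound existed, some
  times \<open>t n\<close> tending to 0 would have operators of unbounded norm although every orbit
  converges along them, against uniform boundedness.\<close>

lemma c0_bounded_near_0:
  obtains \<delta> M where "\<delta> > 0" "\<And>t x. 0 \<le> t \<Longrightarrow> t \<le> \<delta> \<Longrightarrow> norm (T t x) \<le> M * norm x"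
proof (rule ccontr)
  assume "\<not> thesis"
  then have "\<forall>n::nat. \<exists>t. \<exists>x. 0 \<le> t \<and> t \<le> 1 / real (Suc n) \<and> norm (T t x) > real (Suc n) * norm x"
    using that by (metis not_le of_nat_0_less_iff zero_less_Suc zero_less_divide_1_iff)
  then obtain t x where tx: "\<And>n::nat. 0 \<le> t n" "\<And>n. t n \<le> 1 / real (Suc n)"
    "\<And>n. norm (T (t n) (x n)) > real (Suc n) * norm (x n)"
    by metis
  \<comment> \<open>At time 0 the operator is the identity, which cannot violate the bound;
    positivity is what lets \<open>t\<close> tend to 0 in the sense of
    \<open>at_right 0\<close>.\<close>
  have pos: "t n > 0" for n
  proof (rule ccontr)
    assume "\<not> t n > 0"
    then have "t n = 0" using tx(1)[of n] by simp
    then have "real n * norm (x n) < 0" using tx(3)[of n] by (simp add: c0_zero algebra_simps)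
    then show False by (simp add: mult_less_0_iff)
  qed
  have "t \<longlonglongrightarrow> 0"
    by (rule tendsto_sandwich[OF _ _ tendsto_const LIMSEQ_inverse_real_of_nat])
      (use tx in \<open>auto simp: inverse_eq_divide\<close>)
  then have lim: "filterlim t (at_right 0) sequentially"
    using pos by (auto simp: filterlim_at less_imp_neq[symmetric] intro!: always_eventually)
  have "\<exists>M. \<forall>n\<in>UNIV. norm (T (t n) z) \<le> M" for z
  proof -
    have "(\<lambda>n. T (t n) z) \<longlonglongrightarrow> z"
      by (rule filterlim_compose[OF c0_tendsto lim])
    then have "Bseq (\<lambda>n. T (t n) z)"
      using convergentI convergent_imp_Bseq by blast
    then show ?thesis by (auto simp: Bseq_def)
  qed
  then obtain M where M: "\<And>n z. norm (T (t n) z) \<le> M * norm z"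
    using pointwise_bounded_imp_uniformly_bounded[of UNIV "\<lambda>n. T (t n)"] c0_bounded_linear tx(1)
    by (metis UNIV_I)
  obtain n where n: "M \<le> real n" using real_arch_simple by blast
  have "norm (T (t n) (x n)) \<le> real (Suc n) * norm (x n)"
    by (rule order_trans[OF M]) (use n in \<open>auto intro!: mult_right_mono\<close>)
  then show False using tx(3)[of n] by simp
qed

text \<open>A time up to \<open>a\<close> consists of at most \<open>n\<close> steps of length at
  most \<open>\<delta>\<close>, so the semigroup law gives the bound \<open>M ^ n\<close>. Raising
  \<open>M\<close> to at least 1 lets this power also dominate shorter times.\<close>

lemma c0_bounded_on:
  obtains M where "M \<ge> 0" "\<And>t x. 0 \<le> t \<Longrightarrow> t \<le> a \<Longrightarrow> norm (T t x) \<le> M * norm x"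
proof -
  obtain \<delta> M0 where d: "\<delta> > 0" "\<And>t x. 0 \<le> t \<Longrightarrow> t \<le> \<delta> \<Longrightarrow> norm (T t x) \<le> M0 * norm x"
    using c0_bounded_near_0 by metis
  define M where "M = max M0 1"
  have M: "M \<ge> 1" by (simp add: M_def)
  have d2: "norm (T t x) \<le> M * norm x" if "0 \<le> t" "t \<le> \<delta>" for t x
    by (rule order_trans[OF d(2)[OF that]]) (auto simp: M_def intro!: mult_right_mono)
  have *: "0 \<le> t \<Longrightarrow> t \<le> real n * \<delta> \<Longrightarrow> norm (T t x) \<le> M ^ n * norm x" for n t x
  proof (induction n arbitrary: t)
    case 0
    then show ?case by (simp add: c0_zero)
  next
    case (Suc n)
    show ?case
    proof (cases "t \<le> \<delta>")
      case True
      have "norm (T t x) \<le> M * norm x" using d2 Suc.prems True by blast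
      also have "\<dots> \<le> M ^ Suc n * norm x"
        using M by (intro mult_right_mono) (auto intro: self_le_power)
      finally show ?thesis .
    next
      case False
      have "T t x = T \<delta> (T (t - \<delta>) x)"
        using c0_add[of \<delta> "t - \<delta>" x] False d(1) by simp
      then have "norm (T t x) \<le> M * norm (T (t - \<delta>) x)"
        using d2[of \<delta>] d(1) by simp
      also have "\<dots> \<le> M * (M ^ n * norm x)"
        using Suc False M by (intro mult_left_mono Suc.IH) (auto simp: algebra_simps)
      finally show ?thesis by simp
    qed
  qed
  obtain n where "a / \<delta> \<le> real n" using real_arch_simple by blast
  then have "a \<le> real n * \<delta>" using d(1) by (simp add: field_simps)
  then show ?thesis using *[of _ n] M by (intro that[of "M ^ n"]) auto
qed

text \<open>Up to sign, an increment between \<open>s\<close> and \<open>t\<close> is the operator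
  at time \<open>min s t\<close> applied to the increment at 0 over
  \<open>\<bar>s - t\<bar>\<close>. The operators are uniformly bounded on
  \<open>[0, t + 1]\<close>, so right continuity at 0 gives continuity from both sides.\<close>

lemma c0_continuous_on: "continuous_on {0..} (\<lambda>t. T t x)"
  unfolding continuous_on_def
proof
  fix t :: real assume t: "t \<in> {0..}"
  obtain M where M: "M \<ge> 0" "\<And>s x. 0 \<le> s \<Longrightarrow> s \<le> t + 1 \<Longrightarrow> norm (T s x) \<le> M * norm x"
    using c0_bounded_on[of "t + 1"] by metis
  have "((\<lambda>s. M * norm (T \<bar>s - t\<bar> x - x)) \<longlongrightarrow> M * norm (x - x)) (at t within {0..})"
    by (intro tendsto_intros filterlim_compose[OF c0_tendsto tendsto_abs_diff_at_right])
  then have lim: "((\<lambda>s. M * norm (T \<bar>s - t\<bar> x - x)) \<longlongrightarrow> 0) (at t within {0..})" by simp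
  have ev: "\<forall>\<^sub>F s in at t within {0..}. s < t + 1"
    by (rule order_tendstoD(2)[OF tendsto_ident_at]) simp
  have "\<forall>\<^sub>F s in at t within {0..}. norm (T s x - T t x) \<le> M * norm (T \<bar>s - t\<bar> x - x)"
  proof (rule eventually_elim2[OF ev])
    show "\<forall>\<^sub>F s in at t within {0..}. s \<in> {0::real..}"
      by (auto simp: eventually_at_filter)
    fix s :: real assume s: "s < t + 1" "s \<in> {0..}"
    let ?m = "min s t"
    have "T (max s t) x - T ?m x = T ?m (T \<bar>s - t\<bar> x - x)"
      using c0_add[of ?m "\<bar>s - t\<bar>" x] c0_bounded_linear[of ?m] s t
      by (auto simp: linear_simps min_def max_def split: if_splits)
    moreover have "norm (T s x - T t x) = norm (T (max s t) x - T ?m x)"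
      by (auto simp: min_def max_def norm_minus_commute)
    ultimately show "norm (T s x - T t x) \<le> M * norm (T \<bar>s - t\<bar> x - x)"
      using M(2)[of ?m] s t by simp
  qed
  then show "((\<lambda>s. T s x) \<longlongrightarrow> T t x) (at t within {0..})"
    by (rule LIM_zero_cancel[OF Lim_null_comparison[OF _ lim]])
qed

text \<open>The generator records only a right derivative at 0. Quotients on either side of
  \<open>t\<close> are the operator at time \<open>min s t\<close> applied to a quotient at 0, so
  the left derivative is obtained as well.\<close>

lemma c0_has_vector_derivative:
  assumes z: "((\<lambda>h. (T h x - x) /\<^sub>R h) \<longlongrightarrow> z) (at_right 0)" and t: "t \<ge> 0"
  shows "((\<lambda>t. T t x) has_vector_derivative T t z) (at t within {0..})"
proof -
  obtain M where M: "M \<ge> 0" "\<And>s x. 0 \<le> s \<Longrightarrow> s \<le> t + 1 \<Longrightarrow> norm (T s x) \<le> M * norm x"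
    using c0_bounded_on[of "t + 1"] by metis
  let ?q = "\<lambda>h. (T h x - x) /\<^sub>R h"
  \<comment> \<open>The first summand is the error of the quotient at 0, transported by a bounded
    operator; the second pays for the base time being \<open>min s t\<close> instead of
    \<open>t\<close>.\<close>
  let ?B = "\<lambda>s. M * norm (?q \<bar>s - t\<bar> - z) + norm (T (min s t) z - T t z)"
  have c: "((\<lambda>s. T (min s t) z) \<longlongrightarrow> T t z) (at t within {0..})"
  proof -
    have "continuous_on {0..} (\<lambda>s. T (min s t) z)"
      using t by (intro continuous_on_compose2[OF c0_continuous_on]) (auto intro!: continuous_intros)
    then show ?thesis using t by (auto simp: continuous_on_def dest!: bspec[where x=t])
  qed
  have "(?B \<longlongrightarrow> M * norm (z - z) + norm (T t z - T t z)) (at t within {0..})"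
    by (intro tendsto_intros c filterlim_compose[OF z tendsto_abs_diff_at_right])
  then have lim: "(?B \<longlongrightarrow> 0) (at t within {0..})" by simp
  have "\<forall>\<^sub>F s in at t within {0..}. s < t + 1"
    by (rule order_tendstoD(2)[OF tendsto_ident_at]) simp
  moreover have "\<forall>\<^sub>F s in at t within {0..}. s \<in> {0::real..} \<and> s \<noteq> t"
    by (auto simp: eventually_at_filter)
  ultimately have "\<forall>\<^sub>F s in at t within {0..}. norm ((T s x - T t x) /\<^sub>R (s - t) - T t z) \<le> ?B s"
  proof (rule eventually_elim2)
    fix s :: real assume s: "s < t + 1" "s \<in> {0..} \<and> s \<noteq> t"
    let ?m = "min s t" and ?h = "\<bar>s - t\<bar>"
    have bl: "bounded_linear (T ?m)" using s t by (intro c0_bounded_linear) auto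
    have eq: "T (max s t) x - T ?m x = T ?m (T ?h x - x)"
      using c0_add[of ?m ?h x] bl s t
      by (auto simp: linear_simps min_def max_def split: if_splits)
    have "(T s x - T t x) /\<^sub>R (s - t) = T ?m (T ?h x - x) /\<^sub>R ?h"
    proof (cases "s < t")
      case True
      have "inverse (s - t) = - inverse (t - s)"
        by (metis inverse_minus_eq minus_diff_eq)
      then show ?thesis
        unfolding eq[symmetric] using True by (simp add: scaleR_diff_right)
    next
      case False
      then show ?thesis
        unfolding eq[symmetric] by simp
    qed
    then have "(T s x - T t x) /\<^sub>R (s - t) - T t z = T ?m (?q ?h - z) + (T ?m z - T t z)"
      using bl by (simp add: linear_simps)
    then have "norm ((T s x - T t x) /\<^sub>R (s - t) - T t z)
        = norm (T ?m (?q ?h - z) + (T ?m z - T t z))"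
      by (rule arg_cong)
    also have "\<dots> \<le> ?B s"
      using M(2)[of ?m "?q ?h - z"] s t
      by (intro order_trans[OF norm_triangle_ineq] add_mono) auto
    finally show "norm ((T s x - T t x) /\<^sub>R (s - t) - T t z) \<le> ?B s" .
  qed
  then show ?thesis
    unfolding has_vector_derivative_within_iff_quotient
    by (rule LIM_zero_cancel[OF Lim_null_comparison[OF _ lim]])
qed

text \<open>\<open>T t\<close> is bounded and commutes with \<open>T h\<close>, so it can be applied
  under the limit. This is what keeps free orbits inside the domain of the generator.\<close>

lemma c0_generator_commute:
  assumes z: "((\<lambda>h. (T h x - x) /\<^sub>R h) \<longlongrightarrow> z) (at_right 0)" and t: "t \<ge> 0"
  shows "((\<lambda>h. (T h (T t x) - T t x) /\<^sub>R h) \<longlongrightarrow> T t z) (at_right 0)"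
proof -
  have "((\<lambda>h. T t ((T h x - x) /\<^sub>R h)) \<longlongrightarrow> T t z) (at_right 0)"
    by (rule bounded_linear.tendsto[OF c0_bounded_linear[OF t] z])
  moreover have "\<forall>\<^sub>F h in at_right 0. T t ((T h x - x) /\<^sub>R h) = (T h (T t x) - T t x) /\<^sub>R h"
    unfolding eventually_at_filter
    using c0_add[OF t, of _ x] c0_add[OF _ t, of _ x] c0_bounded_linear[OF t]
    by (intro always_eventually) (auto simp: linear_simps add.commute)
  ultimately show ?thesis by (simp add: tendsto_cong)
qed

text \<open>The integral means of an orbit lie in the domain of the generator.\<close>

lemma c0_generator_dense:
  "closure {x. \<exists>z. ((\<lambda>h. (T h x - x) /\<^sub>R h) \<longlongrightarrow> z) (at_right 0)} = UNIV"
proof -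
  have "x \<in> closure {x. \<exists>z. ((\<lambda>h. (T h x - x) /\<^sub>R h) \<longlongrightarrow> z) (at_right 0)}" for x
  proof -
    define F where "F t = integral {0..t} (\<lambda>s. T s x)" for t
    have int: "(\<lambda>s. T s x) integrable_on {a..b}" if "a \<ge> 0" for a b
      using that by (intro integrable_continuous_interval continuous_on_subset[OF c0_continuous_on]) auto
    have F': "((\<lambda>h. (F (t + h) - F t) /\<^sub>R h) \<longlongrightarrow> T t x) (at_right 0)" if t: "t \<ge> 0" for t
    proof -
      have "(F has_vector_derivative T t x) (at t within {0..t+1})"
        unfolding F_def
        by (intro integral_has_vector_derivative continuous_on_subset[OF c0_continuous_on])
          (use t in auto)
      then have "(F has_vector_derivative T t x) (at t within {t..t+1})"
        by (rule has_vector_derivative_within_subset) (use t in auto)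
      then have "((\<lambda>s. (F s - F t) /\<^sub>R (s - t)) \<longlongrightarrow> T t x) (at t within {t..t+1})"
        by (simp add: has_vector_derivative_within_iff_quotient)
      then have "((\<lambda>s. (F s - F t) /\<^sub>R (s - t)) \<longlongrightarrow> T t x) (at_right t)"
        by (simp add: at_within_Icc_at_right)
      then show ?thesis
        by (subst (asm) at_right_to_0) (simp add: filterlim_filtermap add.commute)
    qed
    have dom: "F t \<in> {x. \<exists>z. ((\<lambda>h. (T h x - x) /\<^sub>R h) \<longlongrightarrow> z) (at_right 0)}" if t: "t \<ge> 0" for t
    proof -
      \<comment> \<open>The semigroup law turns \<open>T h\<close> under the integral into a shift
        of the interval. Hence \<open>T h (F t) - F t\<close> is the integral over a short interval
        at \<open>t\<close> minus that over a short interval at 0, and both quotients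
        converge.\<close>
      have shift: "T h (F t) = F (t + h) - F h" if h: "h \<ge> 0" for h
      proof -
        have "T h (F t) = integral {0..t} (\<lambda>s. T h (T s x))"
          unfolding F_def using integral_linear[OF int[of 0 t] c0_bounded_linear[OF h]]
          by (simp add: o_def)
        also have "\<dots> = integral {0..t} (\<lambda>s. T (s + h) x)"
          using c0_add[OF h] by (intro integral_cong) (simp add: add.commute)
        also have "\<dots> = integral {h..t + h} (\<lambda>s. T s x)"
          using integral_shift_cbox[where a=h and c=h and b="t + h" and f="\<lambda>s. T s x"] by simp
        also have "\<dots> = F (t + h) - F h"
          unfolding F_def using Henstock_Kurzweil_Integration.integral_combine[where f="\<lambda>s. T s x" and a=0 and b="t + h" and c=h] int h t
          by (simp add: algebra_simps)
        finally show ?thesis .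
      qed
      have "((\<lambda>h. (F (t + h) - F t) /\<^sub>R h - (F (0 + h) - F 0) /\<^sub>R h) \<longlongrightarrow> T t x - T 0 x) (at_right 0)"
        by (intro tendsto_diff F') (use t in auto)
      moreover have "\<forall>\<^sub>F h in at_right 0. (F (t + h) - F t) /\<^sub>R h - (F (0 + h) - F 0) /\<^sub>R h
          = (T h (F t) - F t) /\<^sub>R h"
        using eventually_at_right_less[of "0::real"]
      proof eventually_elim
        case (elim h)
        have "F 0 = 0" by (simp add: F_def)
        then show ?case using shift[of h] elim by (simp flip: scaleR_diff_right)
      qed
      ultimately show ?thesis by (intro CollectI exI) (rule Lim_transform_eventually)
    qed
    have dom': "F t /\<^sub>R t \<in> {x. \<exists>z. ((\<lambda>h. (T h x - x) /\<^sub>R h) \<longlongrightarrow> z) (at_right 0)}" if t: "t > 0" for t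
    proof -
      obtain z where z: "((\<lambda>h. (T h (F t) - F t) /\<^sub>R h) \<longlongrightarrow> z) (at_right 0)" using dom[of t] t by auto
      have "\<forall>\<^sub>F h in at_right 0. ((T h (F t) - F t) /\<^sub>R h) /\<^sub>R t
         = (T h (F t /\<^sub>R t) - F t /\<^sub>R t) /\<^sub>R h"
        using eventually_at_right_less[of "0::real"]
      proof eventually_elim
        case (elim h)
        then show ?case
          using c0_bounded_linear[of h] by (simp add: linear_simps scaleR_diff_right mult.commute)
      qed
      moreover have "((\<lambda>h. ((T h (F t) - F t) /\<^sub>R h) /\<^sub>R t) \<longlongrightarrow> z /\<^sub>R t) (at_right 0)"
        by (intro tendsto_intros z)
      ultimately show ?thesis by (intro CollectI exI) (rule Lim_transform_eventually)
    qed
    have lim: "((\<lambda>h. F h /\<^sub>R h) \<longlongrightarrow> x) (at_right 0)"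
      using F'[of 0] by (simp add: c0_zero) (simp add: F_def)
    have ev: "\<forall>\<^sub>F h in at_right 0. F h /\<^sub>R h
        \<in> closure {x. \<exists>z. ((\<lambda>h. (T h x - x) /\<^sub>R h) \<longlongrightarrow> z) (at_right 0)}"
      using eventually_at_right_less[of "0::real"]
      by eventually_elim (rule subsetD[OF closure_subset dom'])
    show ?thesis
      by (rule Lim_in_closed_set[OF closed_closure ev _ lim]) simp
  qed
  then show ?thesis by blast
qed

end

section \<open>Square integrable functions\<close>

lemma scaleC_minus_one: "(-1) *\<^sub>C x = - (x::'a::complex_banach)"
  using scaleC_of_real[of "-1" x] by simp

lemma bounded_linear_scaleC: "bounded_linear ((*\<^sub>C) c :: 'a \<Rightarrow> 'a::complex_banach)"
proof (rule bounded_linear_intro[where K="cmod c"])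
  fix r and x y :: 'a
  show "c *\<^sub>C (x + y) = c *\<^sub>C x + c *\<^sub>C y" by (rule scaleC_add_right)
  show "c *\<^sub>C (r *\<^sub>R x) = r *\<^sub>R (c *\<^sub>C x)"
    by (metis scaleC_of_real scaleC_scaleC mult.commute)
  show "norm (c *\<^sub>C x) \<le> norm x * cmod c" by (simp add: norm_scaleC)
qed

section \<open>Strong measurability: algebra, norms and continuous functions\<close>

lemma strongly_measurable_add:
  assumes "strongly_measurable_on I f" "strongly_measurable_on I g"
  shows "strongly_measurable_on I (\<lambda>t. f t + g t)"
proof -
  obtain s where s: "\<And>n. simple_function (lebesgue_on I) (s n)"
    "AE t in lebesgue_on I. (\<lambda>n. s n t) \<longlonglongrightarrow> f t"
    using assms(1) by (auto simp: strongly_measurable_on_def)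
  obtain r where r: "\<And>n. simple_function (lebesgue_on I) (r n)"
    "AE t in lebesgue_on I. (\<lambda>n. r n t) \<longlonglongrightarrow> g t"
    using assms(2) by (auto simp: strongly_measurable_on_def)
  have "AE t in lebesgue_on I. (\<lambda>n. s n t + r n t) \<longlonglongrightarrow> f t + g t"
    using s(2) r(2) by eventually_elim (rule tendsto_add)
  moreover have "simple_function (lebesgue_on I) (\<lambda>t. s n t + r n t)" for n
    by (rule simple_function_compose2[OF s(1) r(1)])
  ultimately show ?thesis
    unfolding strongly_measurable_on_def by (intro exI[of _ "\<lambda>n t. s n t + r n t"]) auto
qed

lemma strongly_measurable_bounded_linear:
  assumes h: "bounded_linear h" and "strongly_measurable_on I f"
  shows "strongly_measurable_on I (\<lambda>t. h (f t))"
proof -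
  obtain s where s: "\<And>n. simple_function (lebesgue_on I) (s n)"
    "AE t in lebesgue_on I. (\<lambda>n. s n t) \<longlonglongrightarrow> f t"
    using assms(2) by (auto simp: strongly_measurable_on_def)
  have "AE t in lebesgue_on I. (\<lambda>n. h (s n t)) \<longlonglongrightarrow> h (f t)"
    using s(2) by eventually_elim (rule bounded_linear.tendsto[OF h])
  moreover have "simple_function (lebesgue_on I) (\<lambda>t. h (s n t))" for n
    by (rule simple_function_compose1[OF s(1)])
  ultimately show ?thesis
    unfolding strongly_measurable_on_def by (intro exI[of _ "\<lambda>n t. h (s n t)"]) auto
qed

lemmas strongly_measurable_scaleC = strongly_measurable_bounded_linear[OF bounded_linear_scaleC]

lemma strongly_measurable_diff:
  assumes "strongly_measurable_on I f" "strongly_measurable_on I g"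
  shows "strongly_measurable_on I (\<lambda>t. f t - g t)"
  using strongly_measurable_add[OF assms(1) strongly_measurable_scaleC[OF assms(2), of "-1"]]
  by (simp add: scaleC_minus_one)

text \<open>Lebesgue measure is complete, so changing a function on a null set keeps it measurable;
  extension by 0 outside \<open>I\<close> reduces the restricted measure to this case.\<close>

lemma borel_measurable_lebesgue_on_AE:
  fixes f g :: "real \<Rightarrow> real"
  assumes I: "I \<in> sets lebesgue" and f: "f \<in> borel_measurable (lebesgue_on I)"
    and ae: "AE t in lebesgue_on I. f t = g t"
  shows "g \<in> borel_measurable (lebesgue_on I)"
proof -
  have "AE t in lebesgue. (if t \<in> I then f t else 0) = (if t \<in> I then g t else 0)"
    using ae I by (subst (asm) AE_restrict_space_iff) (auto elim: eventually_mono)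
  then show ?thesis
    by (intro borel_measurable_if_D[OF borel_measurable_AE[OF borel_measurable_if_I[OF f I]]])
qed

text \<open>The norms of the approximating simple functions are real measurable functions, and their
  limit agrees almost everywhere with the norm of \<open>f\<close>. This makes the energy integrals
  additive and homogeneous.\<close>

lemma strongly_measurable_norm:
  assumes I: "I \<in> sets lebesgue" and f: "strongly_measurable_on I f"
  shows "(\<lambda>t. norm (f t)) \<in> borel_measurable (lebesgue_on I)"
proof -
  obtain s where s: "\<And>n. simple_function (lebesgue_on I) (s n)"
    "AE t in lebesgue_on I. (\<lambda>n. s n t) \<longlonglongrightarrow> f t"
    using f by (auto simp: strongly_measurable_on_def)
  have [measurable]: "(\<lambda>t. norm (s n t)) \<in> borel_measurable (lebesgue_on I)" for n
    by (intro borel_measurable_simple_function simple_function_compose1[OF s(1)])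
  have "(\<lambda>t. lim (\<lambda>n. norm (s n t))) \<in> borel_measurable (lebesgue_on I)"
    by measurable
  moreover have "AE t in lebesgue_on I. lim (\<lambda>n. norm (s n t)) = norm (f t)"
    using s(2) by eventually_elim (auto intro!: limI tendsto_norm)
  ultimately show ?thesis by (rule borel_measurable_lebesgue_on_AE[OF I])
qed

lemma continuous_simple_function_approx:
  fixes f :: "real \<Rightarrow> 'a::metric_space"
  assumes f: "continuous_on {0..\<tau>} f" and e: "e > 0"
  obtains s where "simple_function (lebesgue_on {0..\<tau>}) s" "\<And>t. t \<in> {0..\<tau>} \<Longrightarrow> dist (s t) (f t) < e"
proof -
  have "uniformly_continuous_on {0..\<tau>} f"
    by (intro compact_uniformly_continuous f compact_Icc)
  then obtain d where d: "d > 0"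
    "\<And>t r. t \<in> {0..\<tau>} \<Longrightarrow> r \<in> {0..\<tau>} \<Longrightarrow> dist r t < d \<Longrightarrow> dist (f r) (f t) < e"
    using e unfolding uniformly_continuous_on_def by metis
  \<comment> \<open>The approximant samples \<open>f\<close> at \<open>t\<close> rounded down to the
    grid of mesh \<open>d\<close>. Rounding down from \<open>t \<ge> 0\<close> stays inside the
    interval, and only finitely many grid points occur.\<close>
  define k where "k t = \<lfloor>t / d\<rfloor>" for t :: real
  have k: "0 \<le> k t" "real_of_int (k t) * d \<le> t" "t < real_of_int (k t) * d + d" if "0 \<le> t" for t
  proof -
    have "real_of_int (k t) \<le> t / d" "t / d < real_of_int (k t) + 1" "0 \<le> k t"
      using that d(1) by (auto simp: k_def)
    then show "0 \<le> k t" "real_of_int (k t) * d \<le> t" "t < real_of_int (k t) * d + d"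
      using d(1) by (simp_all add: field_simps)
  qed
  have "simple_function (lebesgue_on {0..\<tau>}) (\<lambda>t. real_of_int (k t))"
  proof (rule simple_function_borel_measurable)
    have "(\<lambda>t. real_of_int (k t)) \<in> borel_measurable borel"
      unfolding k_def by measurable
    then show "(\<lambda>t. real_of_int (k t)) \<in> borel_measurable (lebesgue_on {0..\<tau>})"
      by (intro measurable_restrict_space1 measurable_completion) simp
    have "k ` {0..\<tau>} \<subseteq> {0..k \<tau>}"
      using d(1) by (auto simp: k_def intro!: floor_mono divide_right_mono)
    then have "finite (k ` {0..\<tau>})" using finite_subset by blast
    then have "finite (real_of_int ` k ` {0..\<tau>})" by (rule finite_imageI)
    then show "finite ((\<lambda>t. real_of_int (k t)) ` space (lebesgue_on {0..\<tau>}))"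
      by (simp add: image_image)
  qed
  then have "simple_function (lebesgue_on {0..\<tau>}) (\<lambda>t. f (real_of_int (k t) * d))"
    by (rule simple_function_compose1)
  moreover have "dist (f (real_of_int (k t) * d)) (f t) < e" if "t \<in> {0..\<tau>}" for t
    using that k[of t] d(1) by (intro d(2)) (auto simp: dist_real_def)
  ultimately show ?thesis by (rule that)
qed

text \<open>Diagonal choice: a simple function uniformly within \<open>1 / (k + 1)\<close> of
  \<open>g k\<close> has the same pointwise limit as \<open>g k\<close>.\<close>

lemma strongly_measurable_AE_limit_continuous:
  assumes g: "\<And>k::nat. continuous_on {0..\<tau>} (g k)"
    and lim: "AE t in lebesgue_on {0..\<tau>}. (\<lambda>k. g k t) \<longlonglongrightarrow> f t"
  shows "strongly_measurable_on {0..\<tau>} f"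
proof -
  have "\<exists>s. simple_function (lebesgue_on {0..\<tau>}) s \<and>
      (\<forall>t\<in>{0..\<tau>}. dist (s t) (g k t) < inverse (real (Suc k)))" for k
    by (rule continuous_simple_function_approx[OF g[of k], of "inverse (real (Suc k))"]) auto
  then obtain s where s: "\<And>k. simple_function (lebesgue_on {0..\<tau>}) (s k)"
    "\<And>k t. t \<in> {0..\<tau>} \<Longrightarrow> dist (s k t) (g k t) < inverse (real (Suc k))"
    by metis
  have "AE t in lebesgue_on {0..\<tau>}. (\<lambda>k. s k t) \<longlonglongrightarrow> f t"
    using lim AE_space
  proof eventually_elim
    case (elim t)
    then have "\<forall>k. norm (s k t - g k t) \<le> inverse (real (Suc k))"
      using s(2)[of t] by (auto simp: dist_norm less_imp_le)
    then have "(\<lambda>k. s k t - g k t) \<longlonglongrightarrow> 0"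
      by (intro Lim_null_comparison[OF _ LIMSEQ_inverse_real_of_nat] always_eventually)
    from tendsto_add[OF this elim(1)] show ?case by simp
  qed
  then show ?thesis using s(1) by (auto simp: strongly_measurable_on_def)
qed

lemma strongly_measurable_continuous:
  "continuous_on {0..\<tau>} f \<Longrightarrow> strongly_measurable_on {0..\<tau>} f"
  by (rule strongly_measurable_AE_limit_continuous[of \<tau> "\<lambda>k. f"]) auto

section \<open>Energies, norms and convergence of square integrable functions\<close>

definition l2_energy :: "real set \<Rightarrow> (real \<Rightarrow> 'a::real_normed_vector) \<Rightarrow> ennreal" where
  "l2_energy I f = (\<integral>\<^sup>+t. ennreal ((norm (f t))\<^sup>2) \<partial>lebesgue_on I)"

lemma L2_iff: "f \<in> L2 I \<longleftrightarrow> strongly_measurable_on I f \<and> l2_energy I f < \<infinity>"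
  by (simp add: L2_def l2_energy_def)

lemma nn_integral_lebesgue_on_mono:
  assumes "I \<subseteq> J" "I \<in> sets lebesgue" "J \<in> sets lebesgue"
  shows "(\<integral>\<^sup>+t. h t \<partial>lebesgue_on I) \<le> (\<integral>\<^sup>+t. h t \<partial>lebesgue_on J)"
proof -
  have "(\<integral>\<^sup>+t. h t * indicator I t \<partial>lebesgue) \<le> (\<integral>\<^sup>+t. h t * indicator J t \<partial>lebesgue)"
    using assms(1) by (intro nn_integral_mono) (auto simp: indicator_def)
  then show ?thesis using assms by (simp add: nn_integral_restrict_space)
qed

lemma l2_energy_mono:
  assumes "I \<subseteq> J" "I \<in> sets lebesgue" "J \<in> sets lebesgue"
  shows "l2_energy I f \<le> l2_energy J f"
  unfolding l2_energy_def by (rule nn_integral_lebesgue_on_mono[OF assms])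

lemma l2_energy_scaleC:
  assumes "(\<lambda>t. norm (f t)) \<in> borel_measurable (lebesgue_on I)"
  shows "l2_energy I (\<lambda>t. c *\<^sub>C f t) = ennreal ((cmod c)\<^sup>2) * l2_energy I f"
  using assms unfolding l2_energy_def
  by (subst nn_integral_cmult[symmetric])
    (auto simp: norm_scaleC power_mult_distrib ennreal_mult'' intro!: nn_integral_cong)

text \<open>Young's inequality, obtained by dividing the square of
  \<open>e * norm a - norm b\<close> by \<open>e\<close>. The parameter is kept free: optimizing it
  after integration yields the triangle inequality in L2.\<close>

lemma norm_add_sq_le:
  fixes a b :: "'a::real_normed_vector" and e :: real
  assumes "e > 0"
  shows "(norm (a + b))\<^sup>2 \<le> (1 + e) * (norm a)\<^sup>2 + (1 + 1 / e) * (norm b)\<^sup>2"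
proof -
  have "(norm (a + b))\<^sup>2 \<le> (norm a + norm b)\<^sup>2"
    by (intro power_mono norm_triangle_ineq) auto
  also have "\<dots> \<le> (1 + e) * (norm a)\<^sup>2 + (1 + 1 / e) * (norm b)\<^sup>2"
  proof -
    have "0 \<le> (e * norm a - norm b)\<^sup>2 / e" using assms by simp
    also have "\<dots> = e * (norm a)\<^sup>2 - 2 * norm a * norm b + (norm b)\<^sup>2 / e"
      using assms by (simp add: power2_diff power_mult_distrib add_divide_distrib diff_divide_distrib)
        (simp add: power2_eq_square)
    finally show ?thesis by (simp add: power2_sum distrib_right)
  qed
  finally show ?thesis .
qed

lemma l2_energy_add_le:
  assumes I: "I \<in> sets lebesgue" and f: "strongly_measurable_on I f"
    and g: "strongly_measurable_on I g" and e: "e > 0"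
  shows "l2_energy I (\<lambda>t. f t + g t) \<le> ennreal (1 + e) * l2_energy I f + ennreal (1 + 1 / e) * l2_energy I g"
proof -
  note [measurable] = strongly_measurable_norm[OF I f] strongly_measurable_norm[OF I g]
  have "l2_energy I (\<lambda>t. f t + g t) \<le> (\<integral>\<^sup>+t. ennreal (1 + e) * ennreal ((norm (f t))\<^sup>2)
      + ennreal (1 + 1 / e) * ennreal ((norm (g t))\<^sup>2) \<partial>lebesgue_on I)"
    unfolding l2_energy_def
    using norm_add_sq_le[OF e] e
    by (intro nn_integral_mono) (simp flip: ennreal_mult ennreal_plus)
  also have "\<dots> = ennreal (1 + e) * l2_energy I f + ennreal (1 + 1 / e) * l2_energy I g"
    unfolding l2_energy_def by (simp add: nn_integral_add nn_integral_cmult)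
  finally show ?thesis .
qed

lemma L2_add:
  assumes "I \<in> sets lebesgue" "f \<in> L2 I" "g \<in> L2 I"
  shows "(\<lambda>t. f t + g t) \<in> L2 I"
proof -
  have f: "strongly_measurable_on I f" "l2_energy I f < \<infinity>"
    and g: "strongly_measurable_on I g" "l2_energy I g < \<infinity>"
    using assms by (simp_all add: L2_iff)
  have "l2_energy I (\<lambda>t. f t + g t) \<le> ennreal (1 + 1) * l2_energy I f + ennreal (1 + 1 / 1) * l2_energy I g"
    by (rule l2_energy_add_le[OF assms(1) f(1) g(1)]) simp
  also have "\<dots> < \<infinity>"
    using f(2) g(2) by (simp add: ennreal_mult_less_top)
  finally show ?thesis
    unfolding L2_iff using strongly_measurable_add[OF f(1) g(1)] by blast
qed

lemma L2_scaleC: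
  assumes "I \<in> sets lebesgue" "f \<in> L2 I"
  shows "(\<lambda>t. c *\<^sub>C f t) \<in> L2 I"
proof -
  have f: "strongly_measurable_on I f" "l2_energy I f < \<infinity>"
    using assms by (simp_all add: L2_iff)
  then show ?thesis
    unfolding L2_iff l2_energy_scaleC[OF strongly_measurable_norm[OF assms(1) f(1)]]
    using strongly_measurable_scaleC[OF f(1)] by (simp add: ennreal_mult_less_top)
qed

text \<open>Real-valued, so that energies can be subtracted. For infinite energy
  \<open>enn2real\<close> makes this 0, so it represents the energy only for functions in
  \<open>L2 I\<close>.\<close>

definition l2_norm :: "real set \<Rightarrow> (real \<Rightarrow> 'a::real_normed_vector) \<Rightarrow> real" where
  "l2_norm I f = sqrt (enn2real (l2_energy I f))"

lemma l2_energy_eq: "l2_energy I f < \<infinity> \<Longrightarrow> l2_energy I f = ennreal ((l2_norm I f)\<^sup>2)"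
  by (simp add: l2_norm_def less_top)

lemma l2_norm_nonneg [simp]: "0 \<le> l2_norm I f"
  by (simp add: l2_norm_def)

text \<open>Minkowski's inequality without Cauchy-Schwarz: the weighted bound of
  \<open>l2_energy_add_le\<close> is minimal at \<open>e = b / a\<close>, where it equals the square
  of \<open>a + b\<close>.\<close>

lemma l2_norm_add_le:
  assumes I: "I \<in> sets lebesgue" and f: "f \<in> L2 I" and g: "g \<in> L2 I"
  shows "l2_norm I (\<lambda>t. f t + g t) \<le> l2_norm I f + l2_norm I g"
proof -
  define a b c where "a = l2_norm I f" and "b = l2_norm I g" and "c = l2_norm I (\<lambda>t. f t + g t)"
  have nn: "0 \<le> a" "0 \<le> b" "0 \<le> c" by (simp_all add: a_def b_def c_def)
  have *: "c\<^sup>2 \<le> (1 + e) * a\<^sup>2 + (1 + 1 / e) * b\<^sup>2" if e: "e > 0" for e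
  proof -
    have "ennreal (c\<^sup>2) \<le> ennreal (1 + e) * ennreal (a\<^sup>2) + ennreal (1 + 1 / e) * ennreal (b\<^sup>2)"
      using l2_energy_add_le[OF I _ _ e, of f g] f g L2_add[OF I f g]
      by (simp add: L2_iff l2_energy_eq a_def b_def c_def)
    then show ?thesis
      using e by (simp flip: ennreal_mult ennreal_plus)
  qed
  have "c \<le> a + b + d" if d: "d > 0" for d
  proof -
    \<comment> \<open>Shifting both norms by \<open>d / 2\<close> makes them positive, so that the
      optimal weight \<open>b' / a'\<close> exists even when \<open>a\<close> or \<open>b\<close>
      vanishes; the total excess is \<open>d\<close>.\<close>
    define a' b' where "a' = a + d / 2" and "b' = b + d / 2"
    have p: "a' > 0" "b' > 0" using nn d by (auto simp: a'_def b'_def)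
    have "c\<^sup>2 \<le> (1 + b' / a') * a\<^sup>2 + (1 + 1 / (b' / a')) * b\<^sup>2"
      using p by (intro *) auto
    also have "\<dots> \<le> (1 + b' / a') * a'\<^sup>2 + (1 + 1 / (b' / a')) * b'\<^sup>2"
      using p nn d by (intro add_mono mult_left_mono power_mono) (auto simp: a'_def b'_def)
    also have "\<dots> = (a' + b')\<^sup>2"
    proof -
      have "(1 + b' / a') * a'\<^sup>2 = a' * (a' + b')" "(1 + 1 / (b' / a')) * b'\<^sup>2 = b' * (a' + b')"
        using p by (simp_all add: power2_eq_square distrib_right distrib_left mult.commute)
      then show ?thesis by (simp add: power2_eq_square algebra_simps)
    qed
    finally have "c \<le> a' + b'" by (rule power2_le_imp_le) (use p in simp)
    then show ?thesis by (simp add: a'_def b'_def)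
  qed
  then show ?thesis unfolding a_def b_def c_def by (rule field_le_epsilon)
qed

text \<open>Reverse triangle inequality for \<open>l2_norm\<close>. It is available only eventually,
  since early members of the sequence may have infinite energy.\<close>

lemma l2_energy_tendsto:
  assumes I: "I \<in> sets lebesgue" and fk: "\<And>k::nat. strongly_measurable_on I (fk k)" and f: "f \<in> L2 I"
    and lim: "(\<lambda>k. l2_energy I (\<lambda>t. fk k t - f t)) \<longlonglongrightarrow> 0"
  shows "(\<lambda>k. l2_energy I (fk k)) \<longlonglongrightarrow> l2_energy I f"
proof -
  let ?d = "\<lambda>k t. fk k t - f t"
  have sm: "strongly_measurable_on I (?d k)" for k
    using fk f by (auto simp: L2_iff intro: strongly_measurable_diff)
  have "\<forall>\<^sub>F k in sequentially. l2_energy I (?d k) < \<infinity>"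
    using order_tendstoD(2)[OF lim, of \<infinity>] by simp
  then have ev: "\<forall>\<^sub>F k in sequentially. ?d k \<in> L2 I"
    by eventually_elim (simp add: L2_iff sm)
  have dlim: "(\<lambda>k. l2_norm I (?d k)) \<longlonglongrightarrow> 0"
    unfolding l2_norm_def using tendsto_real_sqrt[OF tendsto_enn2real[of _ 0]] lim by force
  have ev2: "\<forall>\<^sub>F k in sequentially. fk k \<in> L2 I \<and> norm (l2_norm I (fk k) - l2_norm I f) \<le> l2_norm I (?d k)"
    using ev
  proof eventually_elim
    case (elim k)
    have 1: "fk k = (\<lambda>t. ?d k t + f t)" by auto
    have in2: "fk k \<in> L2 I" by (subst 1) (rule L2_add[OF I elim f])
    have "l2_norm I (fk k) \<le> l2_norm I (?d k) + l2_norm I f"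
      by (subst 1) (rule l2_norm_add_le[OF I elim f])
    moreover have m: "(\<lambda>t. (-1) *\<^sub>C ?d k t) \<in> L2 I" by (rule L2_scaleC[OF I elim])
    have "l2_norm I (\<lambda>t. fk k t + (-1) *\<^sub>C ?d k t) \<le> l2_norm I (fk k) + l2_norm I (\<lambda>t. (-1) *\<^sub>C ?d k t)"
      by (rule l2_norm_add_le[OF I in2 m])
    then have "l2_norm I f \<le> l2_norm I (fk k) + l2_norm I (?d k)"
      by (simp add: scaleC_minus_one l2_norm_def l2_energy_def norm_minus_commute)
    ultimately show ?case using in2 by auto
  qed
  have "(\<lambda>k. l2_norm I (fk k) - l2_norm I f) \<longlonglongrightarrow> 0"
    by (rule Lim_null_comparison[OF _ dlim]) (use ev2 in \<open>auto elim: eventually_mono\<close>)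
  then have "(\<lambda>k. ennreal ((l2_norm I (fk k))\<^sup>2)) \<longlonglongrightarrow> ennreal ((l2_norm I f)\<^sup>2)"
    by (intro tendsto_ennrealI tendsto_power) (rule LIM_zero_cancel)
  moreover have "\<forall>\<^sub>F k in sequentially. ennreal ((l2_norm I (fk k))\<^sup>2) = l2_energy I (fk k)"
    using ev2 by eventually_elim (simp add: L2_iff l2_energy_eq)
  ultimately have "(\<lambda>k. l2_energy I (fk k)) \<longlonglongrightarrow> ennreal ((l2_norm I f)\<^sup>2)"
    by (rule Lim_transform_eventually)
  then show ?thesis
    using f by (simp add: L2_iff l2_energy_eq)
qed

text \<open>Riesz-Fischer in the form needed for outputs: geometric decay of the energies of
  differences gives almost everywhere convergence, and Fatou's lemma carries the estimate over to
  the limit.\<close>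

lemma l2_energy_limit_of_continuous:
  fixes g :: "nat \<Rightarrow> real \<Rightarrow> 'a::complex_banach"
  assumes g: "\<And>k. continuous_on {0..} (g k)"
    and cau: "\<And>k m. k \<le> m \<Longrightarrow> l2_energy {0..} (\<lambda>t. g m t - g k t) \<le> ennreal ((1/16) ^ k)"
  obtains f where "\<And>\<tau>. strongly_measurable_on {0..\<tau>} f"
    "\<And>k. l2_energy {0..} (\<lambda>t. g k t - f t) \<le> ennreal ((1/16) ^ k)"
proof -
  let ?M = "lebesgue_on {0::real..}"
  have I: "{0::real..} \<in> sets lebesgue" by simp
  have [measurable]: "(\<lambda>t. norm (g m t - g k t)) \<in> borel_measurable ?M" for m k
    by (intro continuous_imp_measurable_on_sets_lebesgue continuous_intros g I)
  define d where "d k t = norm (g (Suc k) t - g k t)" for k t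
  have [measurable]: "d k \<in> borel_measurable ?M" for k
    unfolding d_def by measurable
  \<comment> \<open>The weight \<open>4 ^ k\<close> leaves integrals of size
    \<open>(1/4) ^ k\<close>, still summable. Where this series is finite, with value
    \<open>C\<close>, each increment is at most \<open>sqrt C * (1/2) ^ k\<close>, which is summable
    without the square.\<close>
  let ?W = "\<lambda>t. \<Sum>k. ennreal (4 ^ k * (d k t)\<^sup>2)"
  have "integral\<^sup>N ?M ?W = (\<Sum>k. \<integral>\<^sup>+t. ennreal (4 ^ k * (d k t)\<^sup>2) \<partial>?M)"
    by (intro nn_integral_suminf) measurable
  also have "\<dots> \<le> (\<Sum>k. ennreal ((1/4) ^ k))"
  proof (intro suminf_le allI summableI)
    fix k
    have "(\<integral>\<^sup>+t. ennreal (4 ^ k * (d k t)\<^sup>2) \<partial>?M) = ennreal (4 ^ k) * l2_energy {0..} (\<lambda>t. g (Suc k) t - g k t)"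
      unfolding l2_energy_def
      by (subst nn_integral_cmult[symmetric]) (auto simp: d_def ennreal_mult intro!: nn_integral_cong)
    also have "\<dots> \<le> ennreal (4 ^ k) * ennreal ((1/16) ^ k)"
      by (intro mult_left_mono cau) auto
    also have "\<dots> = ennreal ((1/4) ^ k)"
      by (simp flip: ennreal_mult power_mult_distrib)
    finally show "(\<integral>\<^sup>+t. ennreal (4 ^ k * (d k t)\<^sup>2) \<partial>?M) \<le> ennreal ((1/4) ^ k)" .
  qed
  also have "\<dots> < \<infinity>"
    by (subst suminf_ennreal2) (auto intro!: summable_geometric)
  finally have "integral\<^sup>N ?M ?W \<noteq> \<infinity>" by simp
  then have "AE t in ?M. ?W t \<noteq> \<infinity>"
    by (intro nn_integral_PInf_AE) measurable
  then have conv: "AE t in ?M. (\<lambda>k. g k t) \<longlonglongrightarrow> lim (\<lambda>k. g k t)"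
  proof eventually_elim
    case (elim t)
    define C where "C = enn2real (?W t)"
    have C: "?W t = ennreal C" using elim by (simp add: C_def less_top)
    have C0: "C \<ge> 0" by (simp add: C_def)
    have dk: "d k t \<le> sqrt C * (1/2) ^ k" for k
    proof -
      have "ennreal (4 ^ k * (d k t)\<^sup>2) \<le> ?W t"
        by (rule order_trans[OF _ sum_le_suminf[of _ "{k}"]]) simp_all
      then have "4 ^ k * (d k t)\<^sup>2 \<le> C"
        unfolding C by (rule ennreal_le_iff[OF C0, THEN iffD1])
      then have "(d k t)\<^sup>2 \<le> C * (1/4) ^ k" by (simp add: field_simps)
      also have "\<dots> = (sqrt C * (1/2) ^ k)\<^sup>2"
      proof -
        have "((1/2::real) ^ k)\<^sup>2 = (1/4) ^ k"
          by (simp add: power2_eq_square flip: power_mult_distrib)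
        then show ?thesis using C0 by (simp add: power_mult_distrib)
      qed
      finally show ?thesis by (rule power2_le_imp_le) (simp add: C0)
    qed
    have "summable (\<lambda>k. g (Suc k) t - g k t)"
    proof (rule summable_comparison_test')
      show "summable (\<lambda>k. sqrt C * (1/2) ^ k)"
        by (intro summable_mult summable_geometric) simp
      show "norm (g (Suc k) t - g k t) \<le> sqrt C * (1/2) ^ k" if "k \<ge> 0" for k
        using dk[of k] by (simp add: d_def)
    qed
    then have "convergent (\<lambda>n. \<Sum>k<n. g (Suc k) t - g k t)"
      by (simp add: summable_iff_convergent)
    then have "convergent (\<lambda>n. g n t - g 0 t)"
      by (subst (asm) sum_lessThan_telescope)
    then obtain l where "(\<lambda>n. g n t - g 0 t) \<longlonglongrightarrow> l" by (auto simp: convergent_def)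
    from tendsto_add[OF this tendsto_const[of "g 0 t"]] have "convergent (\<lambda>n. g n t)"
      by (auto simp: convergent_def)
    then show ?case by (simp add: convergent_LIMSEQ_iff)
  qed
  define f where "f t = lim (\<lambda>k. g k t)" for t
  have "strongly_measurable_on {0..\<tau>} f" for \<tau>
  proof (rule strongly_measurable_AE_limit_continuous)
    show "continuous_on {0..\<tau>} (g k)" for k
      by (rule continuous_on_subset[OF g]) auto
    show "AE t in lebesgue_on {0..\<tau>}. (\<lambda>k. g k t) \<longlonglongrightarrow> f t"
      using conv unfolding f_def by (auto simp: AE_restrict_space_iff elim: eventually_mono)
  qed
  moreover have "l2_energy {0..} (\<lambda>t. g k t - f t) \<le> ennreal ((1/16) ^ k)" for k
  proof -
    \<comment> \<open>Fatou's lemma as \<open>m\<close> grows, with \<open>k\<close> fixed; the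
      Cauchy bound depends on \<open>k\<close> alone and so survives the limit.\<close>
    have "l2_energy {0..} (\<lambda>t. g k t - f t) = (\<integral>\<^sup>+t. liminf (\<lambda>m. ennreal ((norm (g m t - g k t))\<^sup>2)) \<partial>?M)"
      unfolding l2_energy_def
    proof (rule nn_integral_cong_AE, use conv in eventually_elim)
      case (elim t)
      have "(\<lambda>m. ennreal ((norm (g m t - g k t))\<^sup>2)) \<longlonglongrightarrow> ennreal ((norm (f t - g k t))\<^sup>2)"
        using elim by (intro tendsto_intros tendsto_ennrealI) (simp add: f_def)
      then have "liminf (\<lambda>m. ennreal ((norm (g m t - g k t))\<^sup>2)) = ennreal ((norm (f t - g k t))\<^sup>2)"
        by (rule lim_imp_Liminf[rotated]) simp
      then show ?case by (simp only: norm_minus_commute[of "g k t" "f t"])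
    qed
    also have "\<dots> \<le> liminf (\<lambda>m. l2_energy {0..} (\<lambda>t. g m t - g k t))"
      unfolding l2_energy_def by (intro nn_integral_liminf) measurable
    also have "\<dots> \<le> liminf (\<lambda>m. ennreal ((1/16) ^ k))"
      by (intro Liminf_mono eventually_sequentiallyI[of k] cau)
    also have "\<dots> = ennreal ((1/16) ^ k)" by (simp add: Liminf_const)
    finally show ?thesis .
  qed
  ultimately show ?thesis by (rule that)
qed

lemma l2_energy_continuous:
  assumes "continuous_on {0..\<tau>} f"
  shows "l2_energy {0..\<tau>} f = ennreal (integral {0..\<tau>} (\<lambda>t. (norm (f t))\<^sup>2))"
proof -
  have "((\<lambda>t. (norm (f t))\<^sup>2) has_integral integral {0..\<tau>} (\<lambda>t. (norm (f t))\<^sup>2)) {0..\<tau>}"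
    by (intro integrable_integral integrable_continuous_interval continuous_intros assms)
  then show ?thesis
    unfolding l2_energy_def
    by (subst nn_integral_restrict_space)
      (simp_all add: nn_integral_completion nn_integral_has_integral_lebesgue')
qed

section \<open>Passage from bounded intervals to the half line\<close>

lemma borel_measurable_lebesgue_on_atLeast:
  fixes h :: "real \<Rightarrow> real"
  assumes "\<And>n::nat. h \<in> borel_measurable (lebesgue_on {0..real n})"
  shows "h \<in> borel_measurable (lebesgue_on {0..})"
proof (rule borel_measurable_if_D, rule borel_measurable_LIMSEQ_metric)
  show "(\<lambda>t. if t \<in> {0..real n} then h t else 0) \<in> borel_measurable lebesgue" for n
    by (intro borel_measurable_if_I assms) simp
  fix t :: real
  obtain N where N: "t \<le> real N" using real_arch_simple by blast
  have "\<forall>\<^sub>F n in sequentially. (if t \<in> {0..real n} then h t else 0) = (if t \<in> {0..} then h t else 0)"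
    using N by (intro eventually_sequentiallyI[of N]) auto
  then show "(\<lambda>n. if t \<in> {0..real n} then h t else 0) \<longlonglongrightarrow> (if t \<in> {0..} then h t else 0)"
    by (rule tendsto_eventually)
qed

lemma nn_integral_atLeast_SUP:
  fixes h :: "real \<Rightarrow> ennreal"
  assumes [measurable]: "h \<in> borel_measurable (lebesgue_on {0..})"
  shows "(\<integral>\<^sup>+t. h t \<partial>lebesgue_on {0..}) = (SUP n. \<integral>\<^sup>+t. h t \<partial>lebesgue_on {0..real n})"
proof -
  let ?h = "\<lambda>t. h t * indicator {0..} t"
  have h: "?h \<in> borel_measurable lebesgue"
    using assms by (subst (asm) borel_measurable_restrict_space_iff_ennreal) auto
  have "(\<integral>\<^sup>+t. h t \<partial>lebesgue_on {0..}) = (\<integral>\<^sup>+t. (SUP n. ?h t * indicator {0..real n} t) \<partial>lebesgue)"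
  proof (subst nn_integral_restrict_space, simp, rule nn_integral_cong)
    fix t :: real
    obtain N where N: "t \<le> real N" using real_arch_simple by blast
    show "?h t = (SUP n. ?h t * indicator {0..real n} t)"
    proof (rule antisym)
      show "?h t \<le> (SUP n. ?h t * indicator {0..real n} t)"
        using N by (intro SUP_upper2[of N]) (auto simp: indicator_def)
      show "(SUP n. ?h t * indicator {0..real n} t) \<le> ?h t"
        by (intro SUP_least) (auto simp: indicator_def)
    qed
  qed
  also have "\<dots> = (SUP n. \<integral>\<^sup>+t. ?h t * indicator {0..real n} t \<partial>lebesgue)"
  proof (intro nn_integral_monotone_convergence_SUP)
    show "incseq (\<lambda>n t. ?h t * indicator {0..real n} t)"
      by (auto simp: incseq_def le_fun_def indicator_def)
    show "(\<lambda>t. ?h t * indicator {0..real n} t) \<in> borel_measurable lebesgue" for n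
      by (rule borel_measurable_times_ennreal[OF h borel_measurable_indicator]) simp
  qed
  also have "\<dots> = (SUP n. \<integral>\<^sup>+t. h t \<partial>lebesgue_on {0..real n})"
    by (intro SUP_cong refl)
      (auto simp: nn_integral_restrict_space indicator_def intro!: nn_integral_cong)
  finally show ?thesis .
qed

lemma l2_norm_tendsto:
  assumes "I \<in> sets lebesgue" and "\<And>k::nat. strongly_measurable_on I (fk k)" and f: "f \<in> L2 I"
    and "(\<lambda>k. l2_energy I (\<lambda>t. fk k t - f t)) \<longlonglongrightarrow> 0"
  shows "(\<lambda>k. l2_norm I (fk k)) \<longlonglongrightarrow> l2_norm I f"
proof -
  have "(\<lambda>k. l2_energy I (fk k)) \<longlonglongrightarrow> ennreal (enn2real (l2_energy I f))"
    using l2_energy_tendsto[OF assms] f by (simp add: L2_iff)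
  then show ?thesis
    unfolding l2_norm_def by (intro tendsto_real_sqrt tendsto_enn2real) auto
qed

lemma L2_continuous:
  assumes "continuous_on {0..\<tau>} f"
  shows "f \<in> L2 {0..\<tau>}"
  using assms by (simp add: L2_iff strongly_measurable_continuous l2_energy_continuous)

lemma l2_norm_sq_continuous:
  assumes "continuous_on {0..\<tau>} f"
  shows "(l2_norm {0..\<tau>} f)\<^sup>2 = integral {0..\<tau>} (\<lambda>t. (norm (f t))\<^sup>2)"
  using assms
  by (simp add: l2_norm_def l2_energy_continuous integral_nonneg integrable_continuous_interval
      continuous_intros)

lemma l2_energy_add_tendsto_0:
  assumes I: "I \<in> sets lebesgue"
    and m: "\<And>k::nat. strongly_measurable_on I (f k)" "\<And>k. strongly_measurable_on I (g k)"
    and f: "(\<lambda>k. l2_energy I (f k)) \<longlonglongrightarrow> 0" and g: "(\<lambda>k. l2_energy I (g k)) \<longlonglongrightarrow> 0"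
  shows "(\<lambda>k. l2_energy I (\<lambda>t. f k t + g k t)) \<longlonglongrightarrow> 0"
proof (rule tendsto_sandwich[OF _ _ tendsto_const])
  show "\<forall>\<^sub>F k in sequentially. l2_energy I (\<lambda>t. f k t + g k t)
      \<le> ennreal (1 + 1) * l2_energy I (f k) + ennreal (1 + 1 / 1) * l2_energy I (g k)"
    by (intro always_eventually allI l2_energy_add_le I m) simp
  have "(\<lambda>k. ennreal (1 + 1) * l2_energy I (f k) + ennreal (1 + 1 / 1) * l2_energy I (g k))
      \<longlonglongrightarrow> ennreal (1 + 1) * 0 + ennreal (1 + 1 / 1) * 0"
    by (intro tendsto_add ennreal_tendsto_cmult f g) auto
  then show "(\<lambda>k. ennreal (1 + 1) * l2_energy I (f k) + ennreal (1 + 1 / 1) * l2_energy I (g k)) \<longlonglongrightarrow> 0"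
    by simp
qed simp

lemma l2_energy_zero [simp]: "l2_energy I (\<lambda>t. 0) = 0"
  by (simp add: l2_energy_def)

lemma l2_norm_zero [simp]: "l2_norm I (\<lambda>t. 0) = 0"
  by (simp add: l2_norm_def)

lemma L2_zero [simp]: "(\<lambda>t. 0) \<in> L2 I"
  by (auto simp: L2_iff strongly_measurable_on_def intro!: exI[of _ "\<lambda>n t. 0"])

lemma l2_energy_atLeast_SUP:
  assumes "\<And>\<tau>. \<tau> > 0 \<Longrightarrow> strongly_measurable_on {0..\<tau>} f"
  shows "l2_energy {0..} f = (SUP n. l2_energy {0..real n} f)"
    and "(\<lambda>t. norm (f t)) \<in> borel_measurable (lebesgue_on {0..})"
proof -
  have "(\<lambda>t. norm (f t)) \<in> borel_measurable (lebesgue_on {0..real n})" for n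
    by (rule measurable_restrict_mono[OF strongly_measurable_norm[OF _ assms[of "real (Suc n)"]]]) auto
  then show [measurable]: "(\<lambda>t. norm (f t)) \<in> borel_measurable (lebesgue_on {0..})"
    by (rule borel_measurable_lebesgue_on_atLeast)
  show "l2_energy {0..} f = (SUP n. l2_energy {0..real n} f)"
    unfolding l2_energy_def by (rule nn_integral_atLeast_SUP) measurable
qed

lemma l2_energy_atLeast_le:
  assumes "\<And>\<tau>. \<tau> > 0 \<Longrightarrow> strongly_measurable_on {0..\<tau>} f"
    and "\<And>\<tau>. \<tau> > 0 \<Longrightarrow> l2_energy {0..\<tau>} f \<le> c"
  shows "l2_energy {0..} f \<le> c"
proof (subst l2_energy_atLeast_SUP(1), rule assms(1), assumption, rule SUP_least)
  fix n :: nat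
  \<comment> \<open>For \<open>n = 0\<close> the interval is degenerate and outside the assumption,
    hence the enlargement to \<open>Suc n\<close>.\<close>
  have "l2_energy {0..real n} f \<le> l2_energy {0..real (Suc n)} f"
    by (rule l2_energy_mono) auto
  also have "\<dots> \<le> c" by (rule assms(2)) simp
  finally show "l2_energy {0..real n} f \<le> c" .
qed

lemma has_integral_norm_sq_derivative:
  fixes x :: "real \<Rightarrow> 'a::real_inner"
  assumes "0 \<le> \<tau>" "\<And>t. t \<ge> 0 \<Longrightarrow> (x has_vector_derivative x' t) (at t within {0..})"
  shows "((\<lambda>t. 2 * inner (x' t) (x t)) has_integral (norm (x \<tau>))\<^sup>2 - (norm (x 0))\<^sup>2) {0..\<tau>}"
  unfolding power2_norm_eq_inner
proof (rule fundamental_theorem_of_calculus[OF assms(1)])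
  fix t assume t: "t \<in> {0..\<tau>}"
  then have "(x has_vector_derivative x' t) (at t within {0..\<tau>})"
    by (intro has_vector_derivative_within_subset[OF assms(2)]) auto
  from bounded_bilinear.has_vector_derivative[OF bounded_bilinear_inner this this]
  show "((\<lambda>t. inner (x t) (x t)) has_vector_derivative 2 * inner (x' t) (x t)) (at t within {0..\<tau>})"
    by (simp add: inner_commute)
qed

section \<open>Linearity of the solution space\<close>

locale linear_node =
  fixes D :: "('x::complex_hilbert \<times> 'u::complex_hilbert) set"
    and S :: "'x \<times> 'u \<Rightarrow> 'x \<times> 'y::complex_hilbert"
  assumes lin: "clinear_on D S"
begin

lemma add_mem: "(x, u) \<in> D \<Longrightarrow> (x', u') \<in> D \<Longrightarrow> (x + x', u + u') \<in> D"
  using lin unfolding clinear_on_def csubspace_def subspace_def by (metis add_Pair)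

lemma scaleC_mem: "(x, u) \<in> D \<Longrightarrow> (c *\<^sub>C x, c *\<^sub>C u) \<in> D"
  using lin unfolding clinear_on_def csubspace_def by (metis fst_conv snd_conv scaleC_prod_def)

lemma S_add: "(x, u) \<in> D \<Longrightarrow> (x', u') \<in> D \<Longrightarrow> S (x + x', u + u') = S (x, u) + S (x', u')"
  using lin unfolding clinear_on_def by (metis add_Pair)

lemma S_scaleC: "(x, u) \<in> D \<Longrightarrow> S (c *\<^sub>C x, c *\<^sub>C u) = c *\<^sub>C S (x, u)"
  using lin unfolding clinear_on_def by (metis fst_conv snd_conv scaleC_prod_def)

lemma diff_mem: "(x, u) \<in> D \<Longrightarrow> (x', u') \<in> D \<Longrightarrow> (x - x', u - u') \<in> D"
  using add_mem[OF _ scaleC_mem[of x' u' "-1"]] by (simp add: scaleC_minus_one)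

lemma S_diff:
  assumes "(x, u) \<in> D" "(x', u') \<in> D"
  shows "S (x - x', u - u') = S (x, u) - S (x', u')"
  using S_add[OF assms(1) scaleC_mem[OF assms(2), of "-1"]] S_scaleC[OF assms(2), of "-1"]
  by (simp add: scaleC_minus_one)

lemma classical_solution_add:
  assumes "classical_solution D S x u y" "classical_solution D S x2 u2 y2"
  shows "classical_solution D S (\<lambda>t. x t + x2 t) (\<lambda>t. u t + u2 t) (\<lambda>t. y t + y2 t)"
proof -
  obtain x' where x': "continuous_on {0..} x'"
    "\<And>t. t \<ge> 0 \<Longrightarrow> (x has_vector_derivative x' t) (at t within {0..})"
    "\<And>t. t \<ge> 0 \<Longrightarrow> (x t, u t) \<in> D" "\<And>t. t \<ge> 0 \<Longrightarrow> (x' t, y t) = S (x t, u t)"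
    using assms(1) by (auto simp: classical_solution_def)
  obtain x2' where x2': "continuous_on {0..} x2'"
    "\<And>t. t \<ge> 0 \<Longrightarrow> (x2 has_vector_derivative x2' t) (at t within {0..})"
    "\<And>t. t \<ge> 0 \<Longrightarrow> (x2 t, u2 t) \<in> D" "\<And>t. t \<ge> 0 \<Longrightarrow> (x2' t, y2 t) = S (x2 t, u2 t)"
    using assms(2) by (auto simp: classical_solution_def)
  show ?thesis
    unfolding classical_solution_def
  proof (intro conjI exI[of _ "\<lambda>t. x' t + x2' t"] allI impI)
    show "continuous_on {0..} (\<lambda>t. u t + u2 t)" "continuous_on {0..} (\<lambda>t. y t + y2 t)"
      using assms by (auto simp: classical_solution_def intro!: continuous_intros)
    show "continuous_on {0..} (\<lambda>t. x' t + x2' t)"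
      by (intro continuous_intros x' x2')
    fix t :: real assume t: "0 \<le> t"
    show "((\<lambda>t. x t + x2 t) has_vector_derivative x' t + x2' t) (at t within {0..})"
      by (intro has_vector_derivative_add x'(2) x2'(2) t)
    show "(x t + x2 t, u t + u2 t) \<in> D"
      by (intro add_mem x'(3) x2'(3) t)
    show "(x' t + x2' t, y t + y2 t) = S (x t + x2 t, u t + u2 t)"
      using S_add[OF x'(3)[OF t] x2'(3)[OF t]] x'(4)[OF t] x2'(4)[OF t] by (metis add_Pair)
  qed
qed

lemma classical_solution_scaleC:
  assumes "classical_solution D S x u y"
  shows "classical_solution D S (\<lambda>t. c *\<^sub>C x t) (\<lambda>t. c *\<^sub>C u t) (\<lambda>t. c *\<^sub>C y t)"
proof -
  obtain x' where x': "continuous_on {0..} x'"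
    "\<And>t. t \<ge> 0 \<Longrightarrow> (x has_vector_derivative x' t) (at t within {0..})"
    "\<And>t. t \<ge> 0 \<Longrightarrow> (x t, u t) \<in> D" "\<And>t. t \<ge> 0 \<Longrightarrow> (x' t, y t) = S (x t, u t)"
    using assms(1) by (auto simp: classical_solution_def)
  note cont = bounded_linear.continuous_on[OF bounded_linear_scaleC]
  show ?thesis
    unfolding classical_solution_def
  proof (intro conjI exI[of _ "\<lambda>t. c *\<^sub>C x' t"] allI impI)
    show "continuous_on {0..} (\<lambda>t. c *\<^sub>C u t)" "continuous_on {0..} (\<lambda>t. c *\<^sub>C y t)"
      using assms by (auto simp: classical_solution_def intro!: cont)
    show "continuous_on {0..} (\<lambda>t. c *\<^sub>C x' t)"
      by (intro cont x')
    fix t :: real assume t: "0 \<le> t"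
    show "((\<lambda>t. c *\<^sub>C x t) has_vector_derivative c *\<^sub>C x' t) (at t within {0..})"
      by (rule bounded_linear.has_vector_derivative[OF bounded_linear_scaleC x'(2)[OF t]])
    show "(c *\<^sub>C x t, c *\<^sub>C u t) \<in> D"
      by (intro scaleC_mem x'(3) t)
    show "(c *\<^sub>C x' t, c *\<^sub>C y t) = S (c *\<^sub>C x t, c *\<^sub>C u t)"
      using S_scaleC[OF x'(3)[OF t]] x'(4)[OF t] by (metis scaleC_prod_def fst_conv snd_conv)
  qed
qed

lemma classical_solution_diff:
  assumes "classical_solution D S x u y" "classical_solution D S x2 u2 y2"
  shows "classical_solution D S (\<lambda>t. x t - x2 t) (\<lambda>t. u t - u2 t) (\<lambda>t. y t - y2 t)"
  using classical_solution_add[OF assms(1) classical_solution_scaleC[OF assms(2), of "-1"]]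
  by (simp add: scaleC_minus_one)

lemma generalized_solution_approx:
  assumes "generalized_solution D S x u y"
  obtains xs us ys where
    "\<And>k::nat. classical_solution D S (xs k) (us k) (ys k)"
    "\<And>\<tau>. \<tau> > 0 \<Longrightarrow> uniform_limit {0..\<tau>} xs x sequentially"
    "\<And>\<tau>. \<tau> > 0 \<Longrightarrow> (\<lambda>k. l2_energy {0..\<tau>} (\<lambda>t. us k t - u t)) \<longlonglongrightarrow> 0"
    "\<And>\<tau>. \<tau> > 0 \<Longrightarrow> (\<lambda>k. l2_energy {0..\<tau>} (\<lambda>t. ys k t - y t)) \<longlonglongrightarrow> 0"
    "\<And>k \<tau>. us k \<in> L2 {0..\<tau>}" "\<And>k \<tau>. ys k \<in> L2 {0..\<tau>}"
proof -
  obtain xs us ys where "\<forall>k::nat. classical_solution D S (xs k) (us k) (ys k)"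
    and "\<forall>\<tau>>0. uniform_limit {0..\<tau>} xs x sequentially \<and>
      (\<lambda>k. l2_energy {0..\<tau>} (\<lambda>t. us k t - u t)) \<longlonglongrightarrow> 0 \<and>
      (\<lambda>k. l2_energy {0..\<tau>} (\<lambda>t. ys k t - y t)) \<longlonglongrightarrow> 0"
    using assms unfolding generalized_solution_def l2_energy_def[symmetric] by (elim conjE exE)
  then have *:
    "\<And>k. classical_solution D S (xs k) (us k) (ys k)"
    "\<And>\<tau>. \<tau> > 0 \<Longrightarrow> uniform_limit {0..\<tau>} xs x sequentially"
    "\<And>\<tau>. \<tau> > 0 \<Longrightarrow> (\<lambda>k. l2_energy {0..\<tau>} (\<lambda>t. us k t - u t)) \<longlonglongrightarrow> 0"
    "\<And>\<tau>. \<tau> > 0 \<Longrightarrow> (\<lambda>k. l2_energy {0..\<tau>} (\<lambda>t. ys k t - y t)) \<longlonglongrightarrow> 0"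
    by simp_all
  have "continuous_on {0..\<tau>} (us k)" "continuous_on {0..\<tau>} (ys k)" for k \<tau>
    using *(1)[of k] by (auto simp: classical_solution_def elim!: continuous_on_subset)
  then have "us k \<in> L2 {0..\<tau>}" "ys k \<in> L2 {0..\<tau>}" for k \<tau>
    by (auto intro: L2_continuous)
  with * show ?thesis by (rule that)
qed

lemma generalized_solutionD:
  assumes "generalized_solution D S x u y"
  shows "continuous_on {0..} x" "\<tau> > 0 \<Longrightarrow> u \<in> L2 {0..\<tau>}" "\<tau> > 0 \<Longrightarrow> y \<in> L2 {0..\<tau>}"
  using assms by (auto simp: generalized_solution_def)

lemma generalized_solutionI:
  assumes "continuous_on {0..} x" "\<And>\<tau>. \<tau> > 0 \<Longrightarrow> u \<in> L2 {0..\<tau>}" "\<And>\<tau>. \<tau> > 0 \<Longrightarrow> y \<in> L2 {0..\<tau>}"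
    "\<And>k::nat. classical_solution D S (xs k) (us k) (ys k)"
    "\<And>\<tau>. \<tau> > 0 \<Longrightarrow> uniform_limit {0..\<tau>} xs x sequentially"
    "\<And>\<tau>. \<tau> > 0 \<Longrightarrow> (\<lambda>k. l2_energy {0..\<tau>} (\<lambda>t. us k t - u t)) \<longlonglongrightarrow> 0"
    "\<And>\<tau>. \<tau> > 0 \<Longrightarrow> (\<lambda>k. l2_energy {0..\<tau>} (\<lambda>t. ys k t - y t)) \<longlonglongrightarrow> 0"
  shows "generalized_solution D S x u y"
  unfolding generalized_solution_def l2_energy_def[symmetric]
  by (intro conjI allI impI exI[of _ xs] exI[of _ us] exI[of _ ys] assms)

text \<open>Approximating classical solutions add termwise; the error of the sum is the sum of the
  errors, and its energy tends to 0 by the weighted inequality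
  \<open>l2_energy_add_le\<close>.\<close>

lemma generalized_solution_add:
  assumes s1: "generalized_solution D S x u y" and s2: "generalized_solution D S x2 u2 y2"
  shows "generalized_solution D S (\<lambda>t. x t + x2 t) (\<lambda>t. u t + u2 t) (\<lambda>t. y t + y2 t)"
proof -
  obtain xs us ys where 1:
    "\<And>k::nat. classical_solution D S (xs k) (us k) (ys k)"
    "\<And>\<tau>. \<tau> > 0 \<Longrightarrow> uniform_limit {0..\<tau>} xs x sequentially"
    "\<And>\<tau>. \<tau> > 0 \<Longrightarrow> (\<lambda>k. l2_energy {0..\<tau>} (\<lambda>t. us k t - u t)) \<longlonglongrightarrow> 0"
    "\<And>\<tau>. \<tau> > 0 \<Longrightarrow> (\<lambda>k. l2_energy {0..\<tau>} (\<lambda>t. ys k t - y t)) \<longlonglongrightarrow> 0"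
    "\<And>k \<tau>. us k \<in> L2 {0..\<tau>}" "\<And>k \<tau>. ys k \<in> L2 {0..\<tau>}"
    using generalized_solution_approx[OF s1] by blast
  obtain xs2 us2 ys2 where 2:
    "\<And>k::nat. classical_solution D S (xs2 k) (us2 k) (ys2 k)"
    "\<And>\<tau>. \<tau> > 0 \<Longrightarrow> uniform_limit {0..\<tau>} xs2 x2 sequentially"
    "\<And>\<tau>. \<tau> > 0 \<Longrightarrow> (\<lambda>k. l2_energy {0..\<tau>} (\<lambda>t. us2 k t - u2 t)) \<longlonglongrightarrow> 0"
    "\<And>\<tau>. \<tau> > 0 \<Longrightarrow> (\<lambda>k. l2_energy {0..\<tau>} (\<lambda>t. ys2 k t - y2 t)) \<longlonglongrightarrow> 0"
    "\<And>k \<tau>. us2 k \<in> L2 {0..\<tau>}" "\<And>k \<tau>. ys2 k \<in> L2 {0..\<tau>}"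
    using generalized_solution_approx[OF s2] by blast
  note d1 = generalized_solutionD[OF s1] and d2 = generalized_solutionD[OF s2]
  have add_diff: "a + b - (c + d) = (a - c) + (b - d)" for a b c d :: "'c::ab_group_add"
    by simp
  show ?thesis
  proof (rule generalized_solutionI[where xs="\<lambda>k t. xs k t + xs2 k t" and us="\<lambda>k t. us k t + us2 k t"
        and ys="\<lambda>k t. ys k t + ys2 k t"])
    show "continuous_on {0..} (\<lambda>t. x t + x2 t)"
      by (intro continuous_intros d1 d2)
    show "classical_solution D S (\<lambda>t. xs k t + xs2 k t) (\<lambda>t. us k t + us2 k t) (\<lambda>t. ys k t + ys2 k t)" for k
      by (rule classical_solution_add[OF 1(1) 2(1)])
    fix \<tau> :: real assume t: "\<tau> > 0"
    have I: "{0..\<tau>} \<in> sets lebesgue" by simp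
    show "(\<lambda>t. u t + u2 t) \<in> L2 {0..\<tau>}" "(\<lambda>t. y t + y2 t) \<in> L2 {0..\<tau>}"
      by (intro L2_add I d1 d2 t)+
    show "uniform_limit {0..\<tau>} (\<lambda>k t. xs k t + xs2 k t) (\<lambda>t. x t + x2 t) sequentially"
      by (intro uniform_limit_add 1 2 t)
    show "(\<lambda>k. l2_energy {0..\<tau>} (\<lambda>t. us k t + us2 k t - (u t + u2 t))) \<longlonglongrightarrow> 0"
      unfolding add_diff
      using 1(5) 2(5) d1(2) d2(2) t
      by (intro l2_energy_add_tendsto_0 I 1 2 t strongly_measurable_diff) (auto simp: L2_iff)
    show "(\<lambda>k. l2_energy {0..\<tau>} (\<lambda>t. ys k t + ys2 k t - (y t + y2 t))) \<longlonglongrightarrow> 0"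
      unfolding add_diff
      using 1(6) 2(6) d1(3) d2(3) t
      by (intro l2_energy_add_tendsto_0 I 1 2 t strongly_measurable_diff) (auto simp: L2_iff)
  qed
qed

lemma generalized_solution_scaleC:
  assumes s1: "generalized_solution D S x u y"
  shows "generalized_solution D S (\<lambda>t. c *\<^sub>C x t) (\<lambda>t. c *\<^sub>C u t) (\<lambda>t. c *\<^sub>C y t)"
proof -
  obtain xs us ys where 1:
    "\<And>k::nat. classical_solution D S (xs k) (us k) (ys k)"
    "\<And>\<tau>. \<tau> > 0 \<Longrightarrow> uniform_limit {0..\<tau>} xs x sequentially"
    "\<And>\<tau>. \<tau> > 0 \<Longrightarrow> (\<lambda>k. l2_energy {0..\<tau>} (\<lambda>t. us k t - u t)) \<longlonglongrightarrow> 0"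
    "\<And>\<tau>. \<tau> > 0 \<Longrightarrow> (\<lambda>k. l2_energy {0..\<tau>} (\<lambda>t. ys k t - y t)) \<longlonglongrightarrow> 0"
    "\<And>k \<tau>. us k \<in> L2 {0..\<tau>}" "\<And>k \<tau>. ys k \<in> L2 {0..\<tau>}"
    using generalized_solution_approx[OF s1] by blast
  note d1 = generalized_solutionD[OF s1]
  have scaleC_diff: "c *\<^sub>C a - c *\<^sub>C b = c *\<^sub>C (a - b)" for a b :: "'c::complex_banach"
    by (rule linear_diff[OF bounded_linear.linear[OF bounded_linear_scaleC], symmetric])
  have lim: "(\<lambda>k. l2_energy {0..\<tau>} (\<lambda>t. c *\<^sub>C fk k t - c *\<^sub>C f t)) \<longlonglongrightarrow> 0"
    if "\<And>k. fk k \<in> L2 {0..\<tau>}" "f \<in> L2 {0..\<tau>}" "(\<lambda>k. l2_energy {0..\<tau>} (\<lambda>t. fk k t - f t)) \<longlonglongrightarrow> 0"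
    for fk and f :: "real \<Rightarrow> 'c::complex_banach" and \<tau> :: real
  proof -
    have "strongly_measurable_on {0..\<tau>} (\<lambda>t. fk k t - f t)" for k
      using that(1,2) by (intro strongly_measurable_diff) (auto simp: L2_iff)
    then have "l2_energy {0..\<tau>} (\<lambda>t. c *\<^sub>C fk k t - c *\<^sub>C f t)
        = ennreal ((cmod c)\<^sup>2) * l2_energy {0..\<tau>} (\<lambda>t. fk k t - f t)" for k
      unfolding scaleC_diff by (intro l2_energy_scaleC strongly_measurable_norm) auto
    moreover have "(\<lambda>k. ennreal ((cmod c)\<^sup>2) * l2_energy {0..\<tau>} (\<lambda>t. fk k t - f t))
        \<longlonglongrightarrow> ennreal ((cmod c)\<^sup>2) * 0"
      by (intro ennreal_tendsto_cmult that) simp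
    ultimately show ?thesis by simp
  qed
  show ?thesis
  proof (rule generalized_solutionI[where xs="\<lambda>k t. c *\<^sub>C xs k t" and us="\<lambda>k t. c *\<^sub>C us k t"
        and ys="\<lambda>k t. c *\<^sub>C ys k t"])
    show "continuous_on {0..} (\<lambda>t. c *\<^sub>C x t)"
      by (intro bounded_linear.continuous_on[OF bounded_linear_scaleC] d1)
    show "classical_solution D S (\<lambda>t. c *\<^sub>C xs k t) (\<lambda>t. c *\<^sub>C us k t) (\<lambda>t. c *\<^sub>C ys k t)" for k
      by (rule classical_solution_scaleC[OF 1(1)])
    fix \<tau> :: real assume t: "\<tau> > 0"
    show "(\<lambda>t. c *\<^sub>C u t) \<in> L2 {0..\<tau>}" "(\<lambda>t. c *\<^sub>C y t) \<in> L2 {0..\<tau>}"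
      by (intro L2_scaleC d1 t; simp)+
    show "uniform_limit {0..\<tau>} (\<lambda>k t. c *\<^sub>C xs k t) (\<lambda>t. c *\<^sub>C x t) sequentially"
      by (rule bounded_linear.uniform_limit[OF bounded_linear_scaleC 1(2)[OF t]])
    show "(\<lambda>k. l2_energy {0..\<tau>} (\<lambda>t. c *\<^sub>C us k t - c *\<^sub>C u t)) \<longlonglongrightarrow> 0"
      by (rule lim[OF 1(5) d1(2)[OF t] 1(3)[OF t]])
    show "(\<lambda>k. l2_energy {0..\<tau>} (\<lambda>t. c *\<^sub>C ys k t - c *\<^sub>C y t)) \<longlonglongrightarrow> 0"
      by (rule lim[OF 1(6) d1(3)[OF t] 1(4)[OF t]])
  qed
qed

lemma generalized_solution_diff:
  assumes "generalized_solution D S x u y" "generalized_solution D S x2 u2 y2"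
  shows "generalized_solution D S (\<lambda>t. x t - x2 t) (\<lambda>t. u t - u2 t) (\<lambda>t. y t - y2 t)"
  using generalized_solution_add[OF assms(1) generalized_solution_scaleC[OF assms(2), of "-1"]]
  by (simp add: scaleC_minus_one)

end

section \<open>The energy balance\<close>

context linear_node
begin

lemma classical_solutionD:
  assumes "classical_solution D S x u y"
  shows "continuous_on {0..\<tau>} x" "continuous_on {0..\<tau>} u" "continuous_on {0..\<tau>} y"
proof -
  have "continuous_on {0..} x"
    using assms by (auto simp: classical_solution_def continuous_on_eq_continuous_within
        dest!: has_vector_derivative_continuous)
  then show "continuous_on {0..\<tau>} x" by (rule continuous_on_subset) auto
  show "continuous_on {0..\<tau>} u" "continuous_on {0..\<tau>} y"
    using assms by (auto simp: classical_solution_def elim!: continuous_on_subset)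
qed

text \<open>Collects the integral of the stored power, the integral of the supplied power, and the
  membership in \<open>D\<close> that allows the two integrands to be compared pointwise. Passivity
  then gives an inequality, energy preservation an equality.\<close>

lemma classical_solution_energy:
  assumes sol: "classical_solution D S x u y" and \<tau>: "\<tau> \<ge> 0"
  shows "((\<lambda>t. 2 * inner (fst (S (x t, u t))) (x t)) has_integral (norm (x \<tau>))\<^sup>2 - (norm (x 0))\<^sup>2) {0..\<tau>}"
    and "((\<lambda>t. (norm (u t))\<^sup>2 - (norm (y t))\<^sup>2) has_integral
      (l2_norm {0..\<tau>} u)\<^sup>2 - (l2_norm {0..\<tau>} y)\<^sup>2) {0..\<tau>}"
    and "\<And>t. t \<in> {0..\<tau>} \<Longrightarrow> (x t, u t) \<in> D \<and> snd (S (x t, u t)) = y t"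
proof -
  obtain x' where x': "continuous_on {0..} x'"
    "\<And>t. t \<ge> 0 \<Longrightarrow> (x has_vector_derivative x' t) (at t within {0..})"
    "\<And>t. t \<ge> 0 \<Longrightarrow> (x t, u t) \<in> D" "\<And>t. t \<ge> 0 \<Longrightarrow> (x' t, y t) = S (x t, u t)"
    using sol by (auto simp: classical_solution_def)
  show "(x t, u t) \<in> D \<and> snd (S (x t, u t)) = y t" if "t \<in> {0..\<tau>}" for t
    using that x'(3)[of t] x'(4)[of t] by (metis atLeastAtMost_iff snd_conv)
  have "((\<lambda>t. 2 * inner (x' t) (x t)) has_integral (norm (x \<tau>))\<^sup>2 - (norm (x 0))\<^sup>2) {0..\<tau>}"
    by (rule has_integral_norm_sq_derivative[OF \<tau> x'(2)])
  then show "((\<lambda>t. 2 * inner (fst (S (x t, u t))) (x t)) has_integral (norm (x \<tau>))\<^sup>2 - (norm (x 0))\<^sup>2) {0..\<tau>}"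
  proof (rule has_integral_eq[rotated])
    fix t assume "t \<in> {0..\<tau>}"
    then show "2 * inner (x' t) (x t) = 2 * inner (fst (S (x t, u t))) (x t)"
      using x'(4)[of t] by (metis atLeastAtMost_iff fst_conv)
  qed
  note c = classical_solutionD[OF sol]
  show "((\<lambda>t. (norm (u t))\<^sup>2 - (norm (y t))\<^sup>2) has_integral
      (l2_norm {0..\<tau>} u)\<^sup>2 - (l2_norm {0..\<tau>} y)\<^sup>2) {0..\<tau>}"
    unfolding l2_norm_sq_continuous[OF c(2)] l2_norm_sq_continuous[OF c(3)]
    by (intro has_integral_diff integrable_integral integrable_continuous_interval continuous_intros c)
qed

text \<open>The balance involves only the norms of state, input and output, and each of these is
  continuous for the convergence that defines generalized solutions.\<close>

lemma generalized_solution_limits: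
  assumes "generalized_solution D S x u y"
  obtains xs us ys where "\<And>k::nat. classical_solution D S (xs k) (us k) (ys k)"
    "\<And>\<tau>. \<tau> \<ge> 0 \<Longrightarrow> (\<lambda>k. norm (xs k \<tau>)) \<longlonglongrightarrow> norm (x \<tau>)"
    "\<And>\<tau>. \<tau> > 0 \<Longrightarrow> (\<lambda>k. l2_norm {0..\<tau>} (us k)) \<longlonglongrightarrow> l2_norm {0..\<tau>} u"
    "\<And>\<tau>. \<tau> > 0 \<Longrightarrow> (\<lambda>k. l2_norm {0..\<tau>} (ys k)) \<longlonglongrightarrow> l2_norm {0..\<tau>} y"
proof -
  obtain xs us ys where 1:
    "\<And>k::nat. classical_solution D S (xs k) (us k) (ys k)"
    "\<And>\<tau>. \<tau> > 0 \<Longrightarrow> uniform_limit {0..\<tau>} xs x sequentially"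
    "\<And>\<tau>. \<tau> > 0 \<Longrightarrow> (\<lambda>k. l2_energy {0..\<tau>} (\<lambda>t. us k t - u t)) \<longlonglongrightarrow> 0"
    "\<And>\<tau>. \<tau> > 0 \<Longrightarrow> (\<lambda>k. l2_energy {0..\<tau>} (\<lambda>t. ys k t - y t)) \<longlonglongrightarrow> 0"
    "\<And>k \<tau>. us k \<in> L2 {0..\<tau>}" "\<And>k \<tau>. ys k \<in> L2 {0..\<tau>}"
    using generalized_solution_approx[OF assms] by blast
  note d = generalized_solutionD[OF assms]
  show ?thesis
  proof (rule that[OF 1(1)])
    fix \<tau> :: real assume "\<tau> \<ge> 0"
    \<comment> \<open>Convergence is postulated only on intervals of positive length; taking
      \<open>\<tau> + 1\<close> as the length includes the initial time
      \<open>\<tau> = 0\<close>.\<close>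
    then show "(\<lambda>k. norm (xs k \<tau>)) \<longlonglongrightarrow> norm (x \<tau>)"
      by (intro tendsto_norm tendsto_uniform_limitI[OF 1(2)[of "\<tau> + 1"]]) auto
  next
    fix \<tau> :: real assume t: "\<tau> > 0"
    show "(\<lambda>k. l2_norm {0..\<tau>} (us k)) \<longlonglongrightarrow> l2_norm {0..\<tau>} u"
      using 1(5) by (intro l2_norm_tendsto d t 1(3)) (auto simp: L2_iff)
    show "(\<lambda>k. l2_norm {0..\<tau>} (ys k)) \<longlonglongrightarrow> l2_norm {0..\<tau>} y"
      using 1(6) by (intro l2_norm_tendsto d t 1(4)) (auto simp: L2_iff)
  qed
qed

lemma classical_energy_eq:
  assumes pres: "scattering_energy_preserving D S"
    and sol: "classical_solution D S x u y" and \<tau>: "\<tau> \<ge> 0"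
  shows "(l2_norm {0..\<tau>} y)\<^sup>2 + (norm (x \<tau>))\<^sup>2 = (norm (x 0))\<^sup>2 + (l2_norm {0..\<tau>} u)\<^sup>2"
proof -
  note e = classical_solution_energy[OF sol \<tau>]
  have "((\<lambda>t. (norm (u t))\<^sup>2 - (norm (y t))\<^sup>2) has_integral (norm (x \<tau>))\<^sup>2 - (norm (x 0))\<^sup>2) {0..\<tau>}"
    by (rule has_integral_eq[OF _ e(1)])
      (use e(3) pres in \<open>fastforce simp: scattering_energy_preserving_def Re_cinner\<close>)
  from has_integral_unique[OF this e(2)] show ?thesis by simp
qed

lemma generalized_energy_eq:
  assumes pres: "scattering_energy_preserving D S"
    and sol: "generalized_solution D S x u y" and \<tau>: "\<tau> > 0"
  shows "(l2_norm {0..\<tau>} y)\<^sup>2 + (norm (x \<tau>))\<^sup>2 = (norm (x 0))\<^sup>2 + (l2_norm {0..\<tau>} u)\<^sup>2"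
proof -
  obtain xs us ys where 1: "\<And>k::nat. classical_solution D S (xs k) (us k) (ys k)"
    "\<And>\<tau>. \<tau> \<ge> 0 \<Longrightarrow> (\<lambda>k. norm (xs k \<tau>)) \<longlonglongrightarrow> norm (x \<tau>)"
    "\<And>\<tau>. \<tau> > 0 \<Longrightarrow> (\<lambda>k. l2_norm {0..\<tau>} (us k)) \<longlonglongrightarrow> l2_norm {0..\<tau>} u"
    "\<And>\<tau>. \<tau> > 0 \<Longrightarrow> (\<lambda>k. l2_norm {0..\<tau>} (ys k)) \<longlonglongrightarrow> l2_norm {0..\<tau>} y"
    using generalized_solution_limits[OF sol] by blast
  have "(\<lambda>k. (l2_norm {0..\<tau>} (ys k))\<^sup>2 + (norm (xs k \<tau>))\<^sup>2)
      \<longlonglongrightarrow> (l2_norm {0..\<tau>} y)\<^sup>2 + (norm (x \<tau>))\<^sup>2"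
    using \<tau> by (intro tendsto_intros 1) auto
  moreover have "(\<lambda>k. (norm (xs k 0))\<^sup>2 + (l2_norm {0..\<tau>} (us k))\<^sup>2)
      \<longlonglongrightarrow> (norm (x 0))\<^sup>2 + (l2_norm {0..\<tau>} u)\<^sup>2"
    using \<tau> by (intro tendsto_intros 1) auto
  ultimately show ?thesis
    using classical_energy_eq[OF pres 1(1) less_imp_le[OF \<tau>]] LIMSEQ_unique by simp
qed

end

section \<open>Passive nodes: contractivity and free trajectories\<close>

locale passive_node = linear_node D S
  for D :: "('x::complex_hilbert \<times> 'u::complex_hilbert) set"
    and S :: "'x \<times> 'u \<Rightarrow> 'x \<times> 'y::complex_hilbert" +
  fixes T :: "real \<Rightarrow> 'x \<Rightarrow> 'x"
  assumes semigroup: "associated_semigroup D S T"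
    and passivity: "scattering_passive D S"
begin

lemma passive_le:
  "(x, u) \<in> D \<Longrightarrow> 2 * inner (fst (S (x, u))) x \<le> (norm u)\<^sup>2 - (norm (snd (S (x, u))))\<^sup>2"
  using passivity by (auto simp: scattering_passive_def Re_cinner)

lemma classical_energy_le:
  assumes sol: "classical_solution D S x u y" and \<tau>: "\<tau> \<ge> 0"
  shows "(l2_norm {0..\<tau>} y)\<^sup>2 + (norm (x \<tau>))\<^sup>2 \<le> (norm (x 0))\<^sup>2 + (l2_norm {0..\<tau>} u)\<^sup>2"
proof -
  note e = classical_solution_energy[OF sol \<tau>]
  have "(norm (x \<tau>))\<^sup>2 - (norm (x 0))\<^sup>2 \<le> (l2_norm {0..\<tau>} u)\<^sup>2 - (l2_norm {0..\<tau>} y)\<^sup>2"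
  proof (rule has_integral_le[OF e(1) e(2)])
    fix t assume "t \<in> {0..\<tau>}"
    with e(3) show "2 * inner (fst (S (x t, u t))) (x t) \<le> (norm (u t))\<^sup>2 - (norm (y t))\<^sup>2"
      using passive_le[of "x t" "u t"] by metis
  qed
  then show ?thesis by simp
qed

lemma generalized_energy_le:
  assumes sol: "generalized_solution D S x u y" and \<tau>: "\<tau> > 0"
  shows "(l2_norm {0..\<tau>} y)\<^sup>2 + (norm (x \<tau>))\<^sup>2 \<le> (norm (x 0))\<^sup>2 + (l2_norm {0..\<tau>} u)\<^sup>2"
proof -
  obtain xs us ys where 1: "\<And>k::nat. classical_solution D S (xs k) (us k) (ys k)"
    "\<And>\<tau>. \<tau> \<ge> 0 \<Longrightarrow> (\<lambda>k. norm (xs k \<tau>)) \<longlonglongrightarrow> norm (x \<tau>)"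
    "\<And>\<tau>. \<tau> > 0 \<Longrightarrow> (\<lambda>k. l2_norm {0..\<tau>} (us k)) \<longlonglongrightarrow> l2_norm {0..\<tau>} u"
    "\<And>\<tau>. \<tau> > 0 \<Longrightarrow> (\<lambda>k. l2_norm {0..\<tau>} (ys k)) \<longlonglongrightarrow> l2_norm {0..\<tau>} y"
    using generalized_solution_limits[OF sol] by blast
  have "(\<lambda>k. (l2_norm {0..\<tau>} (ys k))\<^sup>2 + (norm (xs k \<tau>))\<^sup>2)
      \<longlonglongrightarrow> (l2_norm {0..\<tau>} y)\<^sup>2 + (norm (x \<tau>))\<^sup>2"
    using \<tau> by (intro tendsto_intros 1) auto
  moreover have "(\<lambda>k. (norm (xs k 0))\<^sup>2 + (l2_norm {0..\<tau>} (us k))\<^sup>2)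
      \<longlonglongrightarrow> (norm (x 0))\<^sup>2 + (l2_norm {0..\<tau>} u)\<^sup>2"
    using \<tau> by (intro tendsto_intros 1) auto
  ultimately show ?thesis
    by (rule LIMSEQ_le) (use classical_energy_le[OF 1(1) less_imp_le[OF \<tau>]] in blast)
qed

lemma c0: "c0_semigroup T"
  and domain_eq: "main_domain D = {x. \<exists>z. ((\<lambda>h. (T h x - x) /\<^sub>R h) \<longlongrightarrow> z) (at_right 0)}"
  and generator: "x \<in> main_domain D \<Longrightarrow>
    ((\<lambda>h. (T h x - x) /\<^sub>R h) \<longlongrightarrow> main_operator S x) (at_right 0)"
  using semigroup by (auto simp: associated_semigroup_def generates_def)

lemma domain_invariant:
  assumes x: "x \<in> main_domain D" and t: "t \<ge> 0"
  shows "T t x \<in> main_domain D" "main_operator S (T t x) = T t (main_operator S x)"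
proof -
  note lim = c0_generator_commute[OF c0 generator[OF x] t]
  then show dom: "T t x \<in> main_domain D" unfolding domain_eq by blast
  show "main_operator S (T t x) = T t (main_operator S x)"
    by (rule tendsto_unique[OF trivial_limit_at_right_real generator[OF dom] lim])
qed

text \<open>By passivity \<open>\<parallel>C x\<parallel>\<^sup>2 \<le> 2 \<parallel>A x\<parallel> \<parallel>x\<parallel>\<close> on the domain of \<open>A\<close>, which makes the output of a free
  trajectory continuous.\<close>

lemma output_bound:
  assumes "(x, 0) \<in> D"
  shows "norm (snd (S (x, 0))) \<le> sqrt (2 * (norm (fst (S (x, 0))) * norm x))"
proof (rule real_le_rsqrt)
  have "(norm (snd (S (x, 0))))\<^sup>2 \<le> - 2 * inner (fst (S (x, 0))) x"
    using passive_le[OF assms] by simp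
  also have "\<dots> \<le> 2 * (norm (fst (S (x, 0))) * norm x)"
    using Cauchy_Schwarz_ineq2[of "fst (S (x, 0))" x] by linarith
  finally show "(norm (snd (S (x, 0))))\<^sup>2 \<le> 2 * (norm (fst (S (x, 0))) * norm x)" .
qed

text \<open>The derivative of the state is the orbit through \<open>main_operator S x\<close>. For
  the output, \<open>output_bound\<close> applied to \<open>T s x - T t x\<close> bounds its
  increment by a multiple of the geometric mean of the increments of these two continuous
  orbits.\<close>

lemma free_classical_solution:
  assumes x: "x \<in> main_domain D"
  shows "classical_solution D S (\<lambda>t. T t x) (\<lambda>t. 0) (\<lambda>t. snd (S (T t x, 0)))"
proof -
  have mem: "(T t x, 0) \<in> D" if "t \<ge> 0" for t
    using domain_invariant[OF x that] by (simp add: main_domain_def)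
  have fst: "fst (S (T t x, 0)) = T t (main_operator S x)" if "t \<ge> 0" for t
    using domain_invariant(2)[OF x that] by (simp add: main_operator_def)
  have cont: "continuous_on {0..} (\<lambda>t. snd (S (T t x, 0)))"
    unfolding continuous_on_def
  proof
    fix t :: real assume t: "t \<in> {0..}"
    let ?b = "\<lambda>s. sqrt (2 * (norm (T s (main_operator S x) - T t (main_operator S x)) * norm (T s x - T t x)))"
    have lim: "((\<lambda>s. T s z) \<longlongrightarrow> T t z) (at t within {0..})" for z
      using c0_continuous_on[OF c0, of z] t by (simp add: continuous_on_def)
    have "(?b \<longlongrightarrow> sqrt (2 * (norm (T t (main_operator S x) - T t (main_operator S x)) * norm (T t x - T t x))))
        (at t within {0..})"
      by (intro tendsto_intros lim)
    then have b: "(?b \<longlongrightarrow> 0) (at t within {0..})" by simp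
    have "\<forall>\<^sub>F s in at t within {0..}. norm (snd (S (T s x, 0)) - snd (S (T t x, 0))) \<le> ?b s"
      unfolding eventually_at_filter
    proof (intro always_eventually allI impI)
      fix s :: real assume s: "s \<in> {0..}"
      have "S (T s x - T t x, 0) = S (T s x, 0) - S (T t x, 0)"
        using S_diff[OF mem[of s] mem[of t]] s t by simp
      then have "fst (S (T s x - T t x, 0)) = T s (main_operator S x) - T t (main_operator S x)"
        "snd (S (T s x - T t x, 0)) = snd (S (T s x, 0)) - snd (S (T t x, 0))"
        using fst[of s] fst[of t] s t by simp_all
      moreover have "(T s x - T t x, 0) \<in> D"
        using diff_mem[OF mem[of s] mem[of t]] s t by simp
      ultimately show "norm (snd (S (T s x, 0)) - snd (S (T t x, 0))) \<le> ?b s"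
        using output_bound by metis
    qed
    then show "((\<lambda>t. snd (S (T t x, 0))) \<longlongrightarrow> snd (S (T t x, 0))) (at t within {0..})"
      by (rule LIM_zero_cancel[OF Lim_null_comparison[OF _ b]])
  qed
  show ?thesis
    unfolding classical_solution_def
  proof (intro conjI exI[of _ "\<lambda>t. T t (main_operator S x)"] allI impI cont)
    show "continuous_on {0..} (\<lambda>t. T t (main_operator S x))" by (rule c0_continuous_on[OF c0])
    fix t :: real assume t: "0 \<le> t"
    show "((\<lambda>t. T t x) has_vector_derivative T t (main_operator S x)) (at t within {0..})"
      by (rule c0_has_vector_derivative[OF c0 generator[OF x] t])
    show "(T t x, 0) \<in> D" by (rule mem[OF t])
    show "(T t (main_operator S x), snd (S (T t x, 0))) = S (T t x, 0)"
      using fst[OF t] by (metis prod.collapse)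
  qed simp
qed

lemma closure_domain: "closure (main_domain D) = UNIV"
  unfolding domain_eq by (rule c0_generator_dense[OF c0])

lemma domain_approx:
  assumes "e > 0"
  obtains x where "x \<in> main_domain D" "norm (x - x0) < e"
  using closure_domain assms unfolding set_eq_iff closure_approachable dist_norm by blast

text \<open>On the domain this is the energy inequality with zero input; both sides are continuous
  in \<open>x\<close> and the domain is dense. It later makes approximating free trajectories
  converge uniformly in time.\<close>

lemma contraction:
  assumes t: "t \<ge> 0"
  shows "norm (T t x) \<le> norm x"
proof -
  have dom: "norm (T t x) \<le> norm x" if "x \<in> main_domain D" for x
  proof -
    have "(norm (T t x))\<^sup>2 \<le> (norm (T 0 x))\<^sup>2"
      using classical_energy_le[OF free_classical_solution[OF that] t] by (smt (verit) l2_norm_zero zero_le_power2 zero_power2)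
    then show ?thesis by (simp add: c0_zero[OF c0])
  qed
  have "closed {x. norm (T t x) \<le> norm x}"
    by (intro closed_Collect_le continuous_intros linear_continuous_on c0_bounded_linear[OF c0] t)
  then have "closure (main_domain D) \<subseteq> {x. norm (T t x) \<le> norm x}"
    by (rule closure_minimal[rotated]) (use dom in auto)
  then show ?thesis by (auto simp: closure_domain)
qed

lemma T_diff: "t \<ge> 0 \<Longrightarrow> T t (x - z) = T t x - T t z"
  using c0_bounded_linear[OF c0] by (simp add: linear_simps)

text \<open>Domain points tending to \<open>x0\<close> give classical free trajectories. The energy
  inequality for their differences bounds the output differences by the distance of the initial
  states, so the outputs converge in L2 on the whole half line.\<close>

lemma free_solution:
  obtains y where "generalized_solution D S (\<lambda>t. T t x0) (\<lambda>t. 0) y"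
    "l2_energy {0..} y \<le> ennreal ((norm x0)\<^sup>2)"
proof -
  \<comment> \<open>With this radius two approximants of index at least \<open>k\<close> are within
    \<open>(1/4) ^ k\<close>, whose square is the rate \<open>(1/16) ^ k\<close> required by
    \<open>l2_energy_limit_of_continuous\<close>.\<close>
  have "\<exists>x. x \<in> main_domain D \<and> norm (x - x0) < (1/4) ^ k / 2" for k :: nat
    using domain_approx[of "(1/4) ^ k / 2" x0] by auto
  then obtain xk where xk: "\<And>k::nat. xk k \<in> main_domain D" "\<And>k. norm (xk k - x0) < (1/4) ^ k / 2"
    by metis
  define g where "g k t = snd (S (T t (xk k), 0))" for k t
  have sol: "classical_solution D S (\<lambda>t. T t (xk k)) (\<lambda>t. 0) (g k)" for k
    unfolding g_def by (rule free_classical_solution[OF xk(1)])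
  have gc: "continuous_on {0..} (g k)" for k
    using sol[of k] by (simp add: classical_solution_def)
  have cau: "l2_energy {0..} (\<lambda>t. g m t - g k t) \<le> ennreal ((1/16) ^ k)" if "k \<le> m" for k m
  proof (rule l2_energy_atLeast_le)
    fix \<tau> :: real assume \<tau>: "\<tau> > 0"
    have c: "continuous_on {0..\<tau>} (\<lambda>t. g m t - g k t)"
      by (intro continuous_on_diff continuous_on_subset[OF gc]) auto
    then show "strongly_measurable_on {0..\<tau>} (\<lambda>t. g m t - g k t)"
      by (rule strongly_measurable_continuous)
    have "norm (xk m - xk k) \<le> norm (xk m - x0) + norm (xk k - x0)"
      using norm_triangle_ineq4[of "xk m - x0" "xk k - x0"] by simp
    also have "\<dots> \<le> (1/4) ^ m / 2 + (1/4) ^ k / 2"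
      using xk(2)[of m] xk(2)[of k] by simp
    also have "\<dots> \<le> (1/4) ^ k"
    proof -
      have "(1/4) ^ m \<le> (1/4::real) ^ k" by (rule power_decreasing[OF that]) auto
      then show ?thesis by linarith
    qed
    finally have le: "(norm (xk m - xk k))\<^sup>2 \<le> ((1/4) ^ k)\<^sup>2"
      by (intro power_mono) auto
    have "(l2_norm {0..\<tau>} (\<lambda>t. g m t - g k t))\<^sup>2 \<le> (norm (xk m - xk k))\<^sup>2"
      using classical_energy_le[OF classical_solution_diff[OF sol sol, of m k] less_imp_le[OF \<tau>]]
      by (simp only: c0_zero[OF c0] diff_self l2_norm_zero) (smt (verit) zero_le_power2 zero_power2)
    also have "\<dots> \<le> ((1/4) ^ k)\<^sup>2" by (rule le)
    also have "\<dots> = (1/16) ^ k" by (simp add: power2_eq_square flip: power_mult_distrib)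
    finally show "l2_energy {0..\<tau>} (\<lambda>t. g m t - g k t) \<le> ennreal ((1/16) ^ k)"
      using L2_continuous[OF c] by (simp add: L2_iff l2_energy_eq)
  qed
  obtain y where y: "\<And>\<tau>. strongly_measurable_on {0..\<tau>} y"
    "\<And>k. l2_energy {0..} (\<lambda>t. g k t - y t) \<le> ennreal ((1/16) ^ k)"
    using l2_energy_limit_of_continuous[OF gc cau] by blast
  have gy: "l2_energy {0..\<tau>} (\<lambda>t. g k t - y t) \<le> ennreal ((1/16) ^ k)" for k \<tau>
    by (rule order_trans[OF l2_energy_mono y(2)]) auto
  have gsol: "generalized_solution D S (\<lambda>t. T t x0) (\<lambda>t. 0) y"
  proof (rule generalized_solutionI[OF c0_continuous_on[OF c0] L2_zero _ sol])
    fix \<tau> :: real assume \<tau>: "\<tau> > 0"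
    \<comment> \<open>The limit \<open>y\<close> inherits finite energy by writing it as
      \<open>g 0\<close> minus the difference \<open>g 0 - y\<close>, both of finite energy on the
      interval.\<close>
    have c: "g 0 \<in> L2 {0..\<tau>}"
      by (intro L2_continuous continuous_on_subset[OF gc]) auto
    have d: "(\<lambda>t. g 0 t - y t) \<in> L2 {0..\<tau>}"
      using strongly_measurable_diff[OF _ y(1), of \<tau> "g 0"] c gy[of \<tau> 0]
      by (auto simp: L2_iff intro: le_less_trans)
    show "y \<in> L2 {0..\<tau>}"
      using L2_add[OF _ c L2_scaleC[OF _ d, of "-1"]] by (simp add: scaleC_minus_one)
    show "uniform_limit {0..\<tau>} (\<lambda>k t. T t (xk k)) (\<lambda>t. T t x0) sequentially"
    proof (rule uniform_limitI)
      fix e :: real assume "e > 0"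
      have "(\<lambda>k. (1/4) ^ k / 2 :: real) \<longlonglongrightarrow> 0 / 2"
        by (intro tendsto_intros) auto
      then have "\<forall>\<^sub>F k in sequentially. (1/4) ^ k / 2 < e"
        using \<open>e > 0\<close> by (intro order_tendstoD(2)) auto
      then show "\<forall>\<^sub>F k in sequentially. \<forall>t\<in>{0..\<tau>}. dist (T t (xk k)) (T t x0) < e"
      proof eventually_elim
        case (elim k)
        show ?case
        proof
          fix t assume t: "t \<in> {0..\<tau>}"
          then have "dist (T t (xk k)) (T t x0) \<le> norm (xk k - x0)"
            using contraction[of t "xk k - x0"] by (simp add: dist_norm T_diff)
          then show "dist (T t (xk k)) (T t x0) < e" using xk(2)[of k] elim by linarith
        qed
      qed
    qed
    show "(\<lambda>k. l2_energy {0..\<tau>} (\<lambda>t. 0 - 0)) \<longlonglongrightarrow> 0" by simp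
    have "(\<lambda>k. ennreal ((1/16) ^ k)) \<longlonglongrightarrow> ennreal 0"
      by (intro tendsto_ennrealI LIMSEQ_power_zero) simp
    then have lim: "(\<lambda>k. ennreal ((1/16) ^ k)) \<longlonglongrightarrow> 0" by simp
    show "(\<lambda>k. l2_energy {0..\<tau>} (\<lambda>t. g k t - y t)) \<longlonglongrightarrow> 0"
      by (rule tendsto_sandwich[OF always_eventually always_eventually tendsto_const lim])
        (simp_all only: gy zero_le simp_thms)
  qed
  moreover have "l2_energy {0..} y \<le> ennreal ((norm x0)\<^sup>2)"
  proof (rule l2_energy_atLeast_le[OF y(1)])
    fix \<tau> :: real assume \<tau>: "\<tau> > 0"
    have "(l2_norm {0..\<tau>} y)\<^sup>2 \<le> (norm x0)\<^sup>2"
      using generalized_energy_le[OF gsol \<tau>]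
      by (simp only: c0_zero[OF c0] diff_self l2_norm_zero) (smt (verit) zero_le_power2 zero_power2)
    then show "l2_energy {0..\<tau>} y \<le> ennreal ((norm x0)\<^sup>2)"
      using generalized_solutionD(3)[OF gsol \<tau>] by (simp add: L2_iff l2_energy_eq)
  qed
  ultimately show ?thesis by (rule that)
qed

end

section \<open>Operators of quadratic forms\<close>

text \<open>The representing vector is the minimizer of \<open>\<phi>\<close>, which is
  \<open>(norm (x - y))\<^sup>2 - (norm y)\<^sup>2\<close> once \<open>y\<close> is known. The
  parallelogram identity makes a minimizing sequence Cauchy, and minimality along each line gives
  the representation.\<close>

lemma riesz_representation:
  fixes f :: "'a::{real_inner,complete_space} \<Rightarrow> real"
  assumes f: "bounded_linear f"
  obtains y where "\<And>x. f x = inner x y"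
proof -
  define \<phi> where "\<phi> x = (norm x)\<^sup>2 - 2 * f x" for x
  obtain K where K: "\<And>x. \<bar>f x\<bar> \<le> norm x * K"
    using bounded_linear.bounded[OF f] by auto
  have lower: "- K\<^sup>2 \<le> \<phi> x" for x
  proof -
    have "0 \<le> (norm x - K)\<^sup>2" by simp
    also have "\<dots> = (norm x)\<^sup>2 - 2 * (norm x * K) + K\<^sup>2" by (simp add: power2_diff)
    also have "\<dots> \<le> \<phi> x + K\<^sup>2" using K[of x] by (simp add: \<phi>_def)
    finally show ?thesis by simp
  qed
  define m where "m = Inf (range \<phi>)"
  have bdd: "bdd_below (range \<phi>)" using lower by (auto intro!: bdd_belowI)
  have m_le: "m \<le> \<phi> x" for x
    unfolding m_def by (rule cInf_lower[OF rangeI bdd])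
  have "\<exists>x. \<phi> x < m + inverse (real (Suc n))" for n
  proof -
    have "Inf (range \<phi>) < m + inverse (real (Suc n))" by (simp add: m_def)
    then show ?thesis using cInf_lessD[of "range \<phi>"] by blast
  qed
  then obtain z where z: "\<And>n. \<phi> (z n) < m + inverse (real (Suc n))" by metis
  have par: "(norm (a - b))\<^sup>2 = 2 * (\<phi> a + \<phi> b - 2 * \<phi> ((1/2) *\<^sub>R (a + b)))" for a b
    using f by (simp add: \<phi>_def power2_norm_eq_inner linear_simps inner_simps algebra_simps inner_commute)
  have dist_le: "(dist (z k) (z n))\<^sup>2 \<le> 2 * (inverse (real (Suc k)) + inverse (real (Suc n)))" for k n
    using par[of "z k" "z n"] m_le[of "(1/2) *\<^sub>R (z k + z n)"] z[of k] z[of n]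
    unfolding dist_norm by argo
  have "Cauchy z"
  proof (rule metric_CauchyI)
    fix e :: real assume e: "e > 0"
    obtain N where N: "inverse (real (Suc N)) < e\<^sup>2 / 4"
      using reals_Archimedean[of "e\<^sup>2 / 4"] e by auto
    show "\<exists>M. \<forall>k\<ge>M. \<forall>n\<ge>M. dist (z k) (z n) < e"
    proof (intro exI[of _ N] allI impI)
      fix k n assume kn: "N \<le> k" "N \<le> n"
      have "inverse (real (Suc k)) \<le> inverse (real (Suc N))" "inverse (real (Suc n)) \<le> inverse (real (Suc N))"
        using kn by (auto intro!: le_imp_inverse_le)
      then have "(dist (z k) (z n))\<^sup>2 < e\<^sup>2" using dist_le[of k n] N by argo
      then show "dist (z k) (z n) < e" by (rule power2_less_imp_less) (use e in simp)
    qed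
  qed
  then obtain y where y: "z \<longlonglongrightarrow> y" using Cauchy_convergent_iff convergent_def by blast
  have "(\<lambda>n. \<phi> (z n)) \<longlonglongrightarrow> \<phi> y"
    unfolding \<phi>_def by (intro tendsto_intros y bounded_linear.tendsto[OF f])
  moreover have "(\<lambda>n. m + inverse (real (Suc n))) \<longlonglongrightarrow> m + 0"
    by (intro tendsto_intros LIMSEQ_inverse_real_of_nat)
  ultimately have "\<phi> y \<le> m + 0"
    by (rule LIMSEQ_le) (use z less_imp_le in blast)
  then have min: "\<phi> y \<le> \<phi> x" for x using m_le[of x] by simp
  have "f x = inner x y" for x
  proof -
    define c N where "c = inner x y - f x" and "N = (norm x)\<^sup>2"
    have N: "N \<ge> 0" by (simp add: N_def)
    have q: "0 \<le> t\<^sup>2 * N + 2 * t * c" for t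
    proof -
      have "(norm (y + t *\<^sub>R x))\<^sup>2 = (norm y)\<^sup>2 + 2 * t * inner x y + t\<^sup>2 * N"
        unfolding N_def power2_norm_eq_inner
        by (simp add: inner_simps inner_commute[of y x]) (simp add: power2_eq_square distrib_left)
      moreover have "f (y + t *\<^sub>R x) = f y + t * f x"
        using f by (simp add: linear_simps)
      ultimately show ?thesis
        using min[of "y + t *\<^sub>R x"] by (simp add: \<phi>_def c_def algebra_simps)
    qed
    \<comment> \<open>This step length makes the variation equal to
      \<open>- t\<^sup>2 * (N + 2)\<close>, so minimality forces \<open>t = 0\<close>. Dividing by
      \<open>N + 1\<close> instead of \<open>N\<close> includes \<open>x = 0\<close>.\<close>
    define t where "t = - c / (N + 1)"
    have c: "c = - t * (N + 1)" using N by (simp add: t_def)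
    have "t\<^sup>2 * N + 2 * t * c = - (t\<^sup>2 * (N + 2))"
      by (subst c) (simp add: power2_eq_square algebra_simps)
    then have "t\<^sup>2 * (N + 2) \<le> 0" using q[of t] by simp
    then have "t = 0" using N by (simp add: mult_le_0_iff)
    then show ?thesis using c by (simp add: c_def)
  qed
  then show ?thesis by (rule that)
qed

lemma additive_bounded_imp_linear:
  fixes g :: "real \<Rightarrow> real"
  assumes add: "\<And>s t. g (s + t) = g s + g t" and bnd: "\<And>t. 0 \<le> t \<Longrightarrow> t \<le> 1 \<Longrightarrow> \<bar>g t\<bar> \<le> M"
  shows "g t = t * g 1"
proof -
  text \<open>The defect \<open>h\<close> is additive with period \<open>1\<close>, hence bounded, hence zero.\<close>
  define h where "h t = g t - t * g 1" for t
  have h_add: "h (s + t) = h s + h t" for s t by (simp add: h_def add algebra_simps)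
  have h0: "h 0 = 0" using h_add[of 0 0] by simp
  have h_minus: "h (- s) = - h s" for s using h_add[of s "- s"] h0 by simp
  have h_mult: "h (real n * s) = real n * h s" for n s
    by (induction n) (simp_all add: h0 h_add distrib_right)
  have h_nat: "h (real n) = 0" for n using h_mult[of n 1] by (simp add: h_def)
  have h_int: "h (real_of_int k) = 0" for k
    by (cases k rule: int_cases2) (simp_all add: h_nat h_minus)
  have bound: "\<bar>h s\<bar> \<le> M + \<bar>g 1\<bar>" for s
  proof -
    have "h s = h (frac s)"
      using h_add[of "real_of_int \<lfloor>s\<rfloor>" "frac s"] by (simp add: h_int frac_def)
    also have "\<bar>\<dots>\<bar> \<le> \<bar>g (frac s)\<bar> + \<bar>frac s\<bar> * \<bar>g 1\<bar>"
      unfolding h_def abs_mult[symmetric] by (rule abs_triangle_ineq4)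
    also have "\<dots> \<le> M + 1 * \<bar>g 1\<bar>"
      using frac_lt_1[of s] frac_ge_0[of s] by (intro add_mono bnd mult_right_mono) auto
    finally show ?thesis by simp
  qed
  have "h t = 0"
  proof (rule ccontr)
    assume "h t \<noteq> 0"
    then obtain n where n: "M + \<bar>g 1\<bar> < real n * \<bar>h t\<bar>"
      using reals_Archimedean3[of "\<bar>h t\<bar>"] by auto
    have "real n * \<bar>h t\<bar> = \<bar>h (real n * t)\<bar>" by (simp add: h_mult abs_mult)
    then show False using n bound[of "real n * t"] by simp
  qed
  then show ?thesis by (simp add: h_def)
qed

section \<open>Complex inner products and self-adjoint operators\<close>

lemma scaleC_minus_left: "(- c) *\<^sub>C x = - (c *\<^sub>C x)"
  using scaleC_scaleC[of "-1" c x] by (simp add: scaleC_minus_one)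

lemma cinner_scaleC_left: "cinner (c *\<^sub>C x) y = cnj c * cinner x y"
  by (metis cinner_commute cinner_scaleC_right complex_cnj_mult)

lemma inner_scaleC_left: "inner (c *\<^sub>C x) y = inner x (cnj c *\<^sub>C y)" for x y :: "'a::complex_hilbert"
  by (simp flip: Re_cinner add: cinner_scaleC_left cinner_scaleC_right)

lemma Im_cinner: "Im (cinner x y) = inner (\<i> *\<^sub>C x) y"
  by (simp flip: Re_cinner add: cinner_scaleC_left)

lemma cinner_self: "cinner x x = complex_of_real ((norm x)\<^sup>2)"
proof (rule complex_eqI)
  show "Re (cinner x x) = Re (complex_of_real ((norm x)\<^sup>2))"
    by (simp add: Re_cinner power2_norm_eq_inner)
  have "Im (cinner x x) = - Im (cinner x x)"
    using arg_cong[OF cinner_commute[of x x], of Im] by simp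
  then show "Im (cinner x x) = Im (complex_of_real ((norm x)\<^sup>2))" by simp
qed

lemma selfadjoint_inner: "selfadjoint P \<Longrightarrow> inner x (P y) = inner (P x) y"
  by (metis Re_cinner selfadjoint_def)

text \<open>The difference \<open>R\<close> is symmetric with vanishing quadratic form; evaluating
  the form at \<open>x + R x\<close> leaves twice the squared norm of \<open>R x\<close>. This gives
  uniqueness of the optimal cost operator.\<close>

lemma selfadjoint_eqI:
  assumes P: "selfadjoint P" and Q: "selfadjoint Q"
    and eq: "\<And>x. cinner x (P x) = cinner x (Q x)"
  shows "P = Q"
proof
  fix x
  define R where "R x = P x - Q x" for x
  have lin: "R (x + y) = R x + R y" for x y
    using P Q by (simp add: R_def selfadjoint_def bounded_clinear_def linear_simps)
  have sym: "inner x (R y) = inner y (R x)" for x y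
    using selfadjoint_inner[OF P, of x y] selfadjoint_inner[OF Q, of x y]
    by (simp add: R_def inner_diff_right inner_commute)
  have zero: "inner x (R x) = 0" for x
    using arg_cong[OF eq[of x], of Re] by (simp add: R_def inner_diff_right Re_cinner)
  have "inner (R x) (R x) = 0"
    using zero[of "x + R x"] zero[of x] zero[of "R x"] sym[of x "R x"]
    by (simp add: lin inner_simps)
  then show "P x = Q x" by (simp add: R_def)
qed

text \<open>The Jordan-von Neumann construction of the operator of a quadratic form.\<close>

lemma quadratic_form_operator:
  fixes V :: "'x::complex_hilbert \<Rightarrow> real"
  assumes par: "\<And>x y. V (x + y) + V (x - y) = 2 * V x + 2 * V y"
    and hom: "\<And>c x. V (c *\<^sub>C x) = (cmod c)\<^sup>2 * V x"
    and nonneg: "\<And>x. 0 \<le> V x" and bnd: "\<And>x. V x \<le> (norm x)\<^sup>2"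
  obtains P where "selfadjoint P" "\<And>x. cinner x (P x) = complex_of_real (V x)"
proof -
  define b where "b x y = (V (x + y) - V (x - y)) / 4" for x y
  have V_minus: "V (- x) = V x" for x using hom[of "-1" x] by (simp add: scaleC_minus_one)
  have V0: "V 0 = 0" using par[of 0 0] by simp
  have b_sym: "b x y = b y x" for x y
    using V_minus[of "x - y"] by (simp add: b_def add.commute)
  have b_self: "b x x = V x" for x using par[of x x] V0 by (simp add: b_def)
  \<comment> \<open>The parallelogram law at \<open>x + y\<close> and at \<open>x - y\<close>, both
    displaced by \<open>z\<close>; the terms in \<open>V z\<close> cancel on subtraction.\<close>
  have b_sum: "b (x + z) y + b (x - z) y = 2 * b x y" for x y z
  proof -
    have "V (x + z + y) + V (x - z + y) = 2 * V (x + y) + 2 * V z"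
      using par[of "x + y" z] by (simp add: algebra_simps)
    moreover have "V (x + z - y) + V (x - z - y) = 2 * V (x - y) + 2 * V z"
      using par[of "x - y" z] by (simp add: algebra_simps)
    ultimately show ?thesis by (simp add: b_def field_simps)
  qed
  have b_0: "b 0 y = 0" for y using V_minus[of y] by (simp add: b_def)
  have b_double: "b (x + x) y = 2 * b x y" for x y using b_sum[of x x y] b_0 by simp
  \<comment> \<open>With \<open>x\<close> the half sum and \<open>z\<close> the half difference of
    \<open>p\<close> and \<open>q\<close>, \<open>b_sum\<close> has \<open>p\<close> and
    \<open>q\<close> on the left, and doubling turns the right side into
    \<open>b (p + q) y\<close>.\<close>
  have b_add: "b (p + q) y = b p y + b q y" for p q y
  proof -
    define x z where "x = (1/2) *\<^sub>R (p + q)" and "z = (1/2) *\<^sub>R (p - q)"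
    have "x + z = p" "x - z = q"
      by (simp_all add: x_def z_def flip: scaleR_add_right scaleR_diff_right)
    moreover have "x + x = p + q"
      by (simp add: x_def flip: scaleR_add_left)
    ultimately show ?thesis using b_sum[of x z y] b_double[of x y] by simp
  qed
  have b_bound: "\<bar>b x y\<bar> \<le> ((norm x)\<^sup>2 + (norm y)\<^sup>2) / 2" for x y
    using par[of x y] nonneg[of "x + y"] nonneg[of "x - y"] bnd[of x] bnd[of y]
    unfolding b_def by (simp add: abs_le_iff)
  \<comment> \<open>Continuity of \<open>V\<close> is not given; real homogeneity comes instead from
    additivity together with the bound of \<open>V\<close> by the squared norm, which controls
    \<open>b\<close> for factors in \<open>[0, 1]\<close>.\<close>
  have b_scale: "b (t *\<^sub>R x) y = t * b x y" for t x y
  proof -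
    have "b (t *\<^sub>R x) y = t * b (1 *\<^sub>R x) y"
    proof (rule additive_bounded_imp_linear)
      show "b ((s + t) *\<^sub>R x) y = b (s *\<^sub>R x) y + b (t *\<^sub>R x) y" for s t
        by (simp add: scaleR_add_left b_add)
      fix t :: real assume t: "0 \<le> t" "t \<le> 1"
      have "(norm (t *\<^sub>R x))\<^sup>2 \<le> (norm x)\<^sup>2"
        using t by (intro power_mono) (auto simp: mult_left_le_one_le)
      then show "\<bar>b (t *\<^sub>R x) y\<bar> \<le> ((norm x)\<^sup>2 + (norm y)\<^sup>2) / 2"
        using b_bound[of "t *\<^sub>R x" y] by argo
    qed
    then show ?thesis by simp
  qed
  have b_scale_right: "b x (t *\<^sub>R y) = t * b x y" for t x y by (metis b_scale b_sym)
  \<comment> \<open>Normalization to unit vectors turns the additive bound \<open>b_bound\<close>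
    into the product bound that makes \<open>b\<close> a bounded form.\<close>
  have b_le: "\<bar>b x y\<bar> \<le> norm x * norm y" for x y
  proof (cases "x = 0 \<or> y = 0")
    case True
    then show ?thesis using b_0[of y] b_0[of x] b_sym[of x 0] by auto
  next
    case False
    have "b (sgn x) (sgn y) = b x y / (norm x * norm y)"
      by (simp add: sgn_div_norm b_scale b_scale_right divide_inverse)
    moreover have "\<bar>b (sgn x) (sgn y)\<bar> \<le> 1"
      using b_bound[of "sgn x" "sgn y"] False by (simp add: norm_sgn)
    ultimately show ?thesis using False by (simp add: abs_mult divide_le_eq)
  qed
  have "\<exists>w. \<forall>x. b x y = inner x w" for y
  proof -
    have "bounded_linear (\<lambda>x. b x y)"
      by (rule bounded_linear_intro[where K="norm y"]) (simp_all add: b_add b_scale b_le)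
    then show ?thesis using riesz_representation by metis
  qed
  then obtain P where P: "\<And>x y. b x y = inner x (P y)" by metis
  have P_eqI: "u = P y" if "\<And>x. inner x u = b x y" for u y
    using that P vector_eq_ldot by metis
  have P_add: "P (x + y) = P x + P y" for x y
    by (rule P_eqI[symmetric]) (metis P b_add b_sym inner_add_right)
  have P_scaleR: "P (r *\<^sub>R x) = r *\<^sub>R P x" for r x
    by (rule P_eqI[symmetric]) (metis P b_scale b_sym inner_scaleR_right)
  have P_norm: "norm (P x) \<le> norm x" for x
  proof -
    have "(norm (P x))\<^sup>2 \<le> norm (P x) * norm x"
      using b_le[of "P x" x] by (simp add: P power2_norm_eq_inner)
    then show ?thesis by (cases "P x = 0") (auto simp: power2_eq_square)
  qed
  \<comment> \<open>\<open>V\<close> is invariant under multiplication by \<open>\<i>\<close>, which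
    therefore acts as a skew map for \<open>b\<close>; this upgrades \<open>P\<close> from real to
    complex linear.\<close>
  have b_i: "b x (\<i> *\<^sub>C y) = b (- (\<i> *\<^sub>C x)) y" for x y
  proof -
    have V_i: "V (\<i> *\<^sub>C z) = V z" for z by (simp add: hom)
    have i_i: "\<i> *\<^sub>C - (\<i> *\<^sub>C x) = x"
      unfolding scaleC_minus_left[symmetric] scaleC_scaleC using scaleC_of_real[of 1 x] by simp
    have "\<i> *\<^sub>C (- (\<i> *\<^sub>C x) + y) = x + \<i> *\<^sub>C y" "\<i> *\<^sub>C (- (\<i> *\<^sub>C x) - y) = x - \<i> *\<^sub>C y"
      by (simp_all only: linear_add[OF bounded_linear.linear[OF bounded_linear_scaleC]]
          linear_diff[OF bounded_linear.linear[OF bounded_linear_scaleC]] i_i)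
    then show ?thesis using V_i unfolding b_def by metis
  qed
  have P_i: "P (\<i> *\<^sub>C y) = \<i> *\<^sub>C P y" for y
  proof (rule P_eqI[symmetric])
    fix x
    have "b x (\<i> *\<^sub>C y) = inner ((- \<i>) *\<^sub>C x) (P y)"
      by (metis b_i P scaleC_minus_left)
    then show "inner x (\<i> *\<^sub>C P y) = b x (\<i> *\<^sub>C y)"
      by (simp only: inner_scaleC_left) simp
  qed
  have scaleC_eq: "c *\<^sub>C x = Re c *\<^sub>R x + Im c *\<^sub>R (\<i> *\<^sub>C x)" for c and x :: 'x
  proof -
    have "c *\<^sub>C x = (complex_of_real (Re c) + complex_of_real (Im c) * \<i>) *\<^sub>C x"
      by (metis complex_eq mult.commute)
    then show ?thesis
      by (simp only: scaleC_add_left scaleC_of_real flip: scaleC_scaleC)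
  qed
  have clin: "bounded_clinear P"
    unfolding bounded_clinear_def
  proof (intro conjI allI)
    show "bounded_linear P"
      by (rule bounded_linear_intro[where K=1]) (simp_all add: P_add P_scaleR P_norm)
    show "P (c *\<^sub>C x) = c *\<^sub>C P x" for c x
      by (simp only: scaleC_eq[of c] P_add P_scaleR P_i)
  qed
  have sym: "inner x (P y) = inner (P x) y" for x y
    by (metis P b_sym inner_commute)
  have sa: "selfadjoint P"
    unfolding selfadjoint_def
  proof (intro conjI clin allI complex_eqI)
    fix x y
    show "Re (cinner x (P y)) = Re (cinner (P x) y)" by (simp add: Re_cinner sym)
    show "Im (cinner x (P y)) = Im (cinner (P x) y)" by (simp add: Im_cinner sym P_i)
  qed
  have "cinner x (P x) = complex_of_real (V x)" for x
  proof (rule complex_eqI)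
    show "Re (cinner x (P x)) = Re (complex_of_real (V x))"
      by (simp add: Re_cinner b_self flip: P)
    have "cinner x (P x) = cnj (cinner x (P x))"
      using sa by (metis cinner_commute selfadjoint_def)
    from arg_cong[OF this, of Im] have "Im (cinner x (P x)) = - Im (cinner x (P x))" by simp
    then show "Im (cinner x (P x)) = Im (complex_of_real (V x))" by simp
  qed
  with sa show ?thesis by (rule that)
qed

section \<open>The optimal cost\<close>

lemma l2_energy_parallelogram:
  fixes f g :: "real \<Rightarrow> 'a::complex_hilbert"
  assumes [measurable]: "(\<lambda>t. norm (f t)) \<in> borel_measurable (lebesgue_on I)"
    "(\<lambda>t. norm (g t)) \<in> borel_measurable (lebesgue_on I)"
    "(\<lambda>t. norm (f t + g t)) \<in> borel_measurable (lebesgue_on I)"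
    "(\<lambda>t. norm (f t - g t)) \<in> borel_measurable (lebesgue_on I)"
  shows "l2_energy I (\<lambda>t. f t + g t) + l2_energy I (\<lambda>t. f t - g t) = 2 * l2_energy I f + 2 * l2_energy I g"
proof -
  have *: "ennreal ((norm (a + b))\<^sup>2) + ennreal ((norm (a - b))\<^sup>2)
      = 2 * ennreal ((norm a)\<^sup>2) + 2 * ennreal ((norm b)\<^sup>2)" for a b :: 'a
  proof -
    have "(norm (a + b))\<^sup>2 + (norm (a - b))\<^sup>2 = 2 * (norm a)\<^sup>2 + 2 * (norm b)\<^sup>2"
      by (simp add: power2_norm_eq_inner inner_simps)
    then have "ennreal ((norm (a + b))\<^sup>2 + (norm (a - b))\<^sup>2) = ennreal (2 * (norm a)\<^sup>2 + 2 * (norm b)\<^sup>2)"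
      by (rule arg_cong)
    then show ?thesis by (simp add: ennreal_mult)
  qed
  have "l2_energy I (\<lambda>t. f t + g t) + l2_energy I (\<lambda>t. f t - g t)
      = (\<integral>\<^sup>+t. ennreal ((norm (f t + g t))\<^sup>2) + ennreal ((norm (f t - g t))\<^sup>2) \<partial>lebesgue_on I)"
    unfolding l2_energy_def by (rule nn_integral_add[symmetric]) measurable
  also have "\<dots> = 2 * l2_energy I f + 2 * l2_energy I g"
    unfolding * l2_energy_def by (simp add: nn_integral_add nn_integral_cmult)
  finally show ?thesis .
qed

context linear_node
begin

lemma generalized_solution_norm_measurable:
  assumes "generalized_solution D S x u y"
  shows "(\<lambda>t. norm (u t)) \<in> borel_measurable (lebesgue_on {0..})"
    and "(\<lambda>t. norm (y t)) \<in> borel_measurable (lebesgue_on {0..})"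
  using generalized_solutionD[OF assms] by (auto intro!: l2_energy_atLeast_SUP(2) simp: L2_iff)

lemma total_cost_eq:
  assumes "generalized_solution D S x u y"
  shows "(\<integral>\<^sup>+t. ennreal ((norm (u t))\<^sup>2 + (norm (y t))\<^sup>2) \<partial>lebesgue_on {0..})
    = l2_energy {0..} u + l2_energy {0..} y"
proof -
  note [measurable] = generalized_solution_norm_measurable[OF assms]
  have "(\<integral>\<^sup>+t. ennreal ((norm (u t))\<^sup>2 + (norm (y t))\<^sup>2) \<partial>lebesgue_on {0..})
    = (\<integral>\<^sup>+t. ennreal ((norm (u t))\<^sup>2) + ennreal ((norm (y t))\<^sup>2) \<partial>lebesgue_on {0..})"
    by simp
  also have "\<dots> = l2_energy {0..} u + l2_energy {0..} y"
    unfolding l2_energy_def by (rule nn_integral_add) measurable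
  finally show ?thesis .
qed

lemma cost_le:
  assumes sol: "generalized_solution D S x u y" and x0: "x 0 = x0"
  shows "cost D S x0 u \<le> l2_energy {0..} u + l2_energy {0..} y"
  unfolding cost_def total_cost_eq[OF sol, symmetric]
  by (rule INF_lower2[of "(x, y)"]) (use sol x0 in auto)

lemma cost_greatest:
  assumes "\<And>x y. generalized_solution D S x u y \<Longrightarrow> x 0 = x0 \<Longrightarrow> c \<le> l2_energy {0..} u + l2_energy {0..} y"
  shows "c \<le> cost D S x0 u"
  unfolding cost_def using assms total_cost_eq by (intro INF_greatest) auto

lemma optimal_cost_le:
  assumes "generalized_solution D S x u y" "u \<in> L2 {0..}"
  shows "optimal_cost D S (x 0) \<le> l2_energy {0..} u + l2_energy {0..} y"
  unfolding optimal_cost_def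
  by (rule INF_lower2[of u]) (rule assms cost_le[OF assms(1) refl])+

lemma optimal_cost_approx:
  assumes "optimal_cost D S x0 < c"
  obtains x u y where "generalized_solution D S x u y" "u \<in> L2 {0..}" "x 0 = x0"
    "l2_energy {0..} u + l2_energy {0..} y < c"
proof -
  obtain u where u: "u \<in> L2 {0..}" "cost D S x0 u < c"
    using assms by (auto simp: optimal_cost_def INF_less_iff)
  from u(2) obtain x y where xy: "generalized_solution D S x u y" "x 0 = x0"
    "(\<integral>\<^sup>+t. ennreal ((norm (u t))\<^sup>2 + (norm (y t))\<^sup>2) \<partial>lebesgue_on {0..}) < c"
    by (auto simp: cost_def INF_less_iff)
  show ?thesis
    using that[OF xy(1) u(1) xy(2)] xy(3) total_cost_eq[OF xy(1)] by simp
qed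

end

section \<open>The optimal value as a quadratic form\<close>

context passive_node
begin

lemma cost_zero_le: "cost D S x0 (\<lambda>t. 0) \<le> ennreal ((norm x0)\<^sup>2)"
proof -
  obtain y where y: "generalized_solution D S (\<lambda>t. T t x0) (\<lambda>t. 0) y"
    "l2_energy {0..} y \<le> ennreal ((norm x0)\<^sup>2)"
    using free_solution .
  then show ?thesis using cost_le[OF y(1), of x0] by (simp add: c0_zero[OF c0])
qed

lemma optimal_cost_le_norm: "optimal_cost D S x0 \<le> ennreal ((norm x0)\<^sup>2)"
  unfolding optimal_cost_def by (rule INF_lower2[of "\<lambda>t. 0"]) (rule L2_zero cost_zero_le)+

text \<open>No information is lost in passing to a real number: the zero input keeps the optimal
  cost finite.\<close>

definition opt_value :: "'x \<Rightarrow> real" where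
  "opt_value x0 = enn2real (optimal_cost D S x0)"

lemma optimal_cost_eq: "optimal_cost D S x0 = ennreal (opt_value x0)"
  using le_less_trans[OF optimal_cost_le_norm[of x0] ennreal_less_top] by (simp add: opt_value_def)

lemma opt_value_nonneg: "0 \<le> opt_value x0"
  by (simp add: opt_value_def)

lemma opt_value_le: "opt_value x0 \<le> (norm x0)\<^sup>2"
  using optimal_cost_le_norm[of x0] by (simp add: optimal_cost_eq)

lemma opt_value_approx:
  assumes "e > 0"
  obtains x u y where "generalized_solution D S x u y" "u \<in> L2 {0..}" "x 0 = x0"
    "l2_energy {0..} u + l2_energy {0..} y \<le> ennreal (opt_value x0 + e)"
proof -
  have "optimal_cost D S x0 < ennreal (opt_value x0 + e)"
    using assms opt_value_nonneg[of x0] by (simp add: optimal_cost_eq ennreal_less_iff)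
  then show ?thesis using optimal_cost_approx that less_imp_le by metis
qed

text \<open>Sum and difference of near-optimal trajectories compete for the sum and difference of
  the initial states, and the energies of inputs and outputs obey the parallelogram law.\<close>

lemma opt_value_parallelogram_le:
  "opt_value (x0 + z0) + opt_value (x0 - z0) \<le> 2 * opt_value x0 + 2 * opt_value z0"
proof (rule field_le_epsilon)
  fix e :: real assume e: "e > 0"
  \<comment> \<open>Each of the two slacks enters with the factor 2, so \<open>e / 4\<close> apiece
    adds up to \<open>e\<close>.\<close>
  obtain x u y where 1: "generalized_solution D S x u y" "u \<in> L2 {0..}" "x 0 = x0"
    "l2_energy {0..} u + l2_energy {0..} y \<le> ennreal (opt_value x0 + e / 4)"
    using opt_value_approx[of "e / 4" x0] e by auto
  obtain z v w where 2: "generalized_solution D S z v w" "v \<in> L2 {0..}" "z 0 = z0"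
    "l2_energy {0..} v + l2_energy {0..} w \<le> ennreal (opt_value z0 + e / 4)"
    using opt_value_approx[of "e / 4" z0] e by auto
  note p = generalized_solution_add[OF 1(1) 2(1)] and m = generalized_solution_diff[OF 1(1) 2(1)]
  have I: "{0::real..} \<in> sets lebesgue" by simp
  have up: "(\<lambda>t. u t + v t) \<in> L2 {0..}" by (rule L2_add[OF I 1(2) 2(2)])
  have um: "(\<lambda>t. u t - v t) \<in> L2 {0..}"
    using L2_add[OF I 1(2) L2_scaleC[OF I 2(2), of "-1"]] by (simp add: scaleC_minus_one)
  note n = generalized_solution_norm_measurable
  have "ennreal (opt_value (x0 + z0) + opt_value (x0 - z0))
      = optimal_cost D S (x0 + z0) + optimal_cost D S (x0 - z0)"
    by (simp add: optimal_cost_eq opt_value_nonneg)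
  also have "\<dots> \<le> (l2_energy {0..} (\<lambda>t. u t + v t) + l2_energy {0..} (\<lambda>t. y t + w t))
      + (l2_energy {0..} (\<lambda>t. u t - v t) + l2_energy {0..} (\<lambda>t. y t - w t))"
    using optimal_cost_le[OF p up] optimal_cost_le[OF m um] by (intro add_mono) (simp_all add: 1(3) 2(3))
  also have "\<dots> = (l2_energy {0..} (\<lambda>t. u t + v t) + l2_energy {0..} (\<lambda>t. u t - v t))
      + (l2_energy {0..} (\<lambda>t. y t + w t) + l2_energy {0..} (\<lambda>t. y t - w t))"
    by (simp add: add_ac)
  also have "\<dots> = (2 * l2_energy {0..} u + 2 * l2_energy {0..} v) + (2 * l2_energy {0..} y + 2 * l2_energy {0..} w)"
    unfolding l2_energy_parallelogram[OF n(1)[OF 1(1)] n(1)[OF 2(1)] n(1)[OF p] n(1)[OF m]]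
      l2_energy_parallelogram[OF n(2)[OF 1(1)] n(2)[OF 2(1)] n(2)[OF p] n(2)[OF m]] ..
  also have "\<dots> = 2 * (l2_energy {0..} u + l2_energy {0..} y) + 2 * (l2_energy {0..} v + l2_energy {0..} w)"
    by (simp add: distrib_left add_ac)
  also have "\<dots> \<le> 2 * ennreal (opt_value x0 + e / 4) + 2 * ennreal (opt_value z0 + e / 4)"
    by (intro add_mono mult_left_mono 1(4) 2(4)) auto
  also have "\<dots> = ennreal (2 * (opt_value x0 + e / 4) + 2 * (opt_value z0 + e / 4))"
  proof -
    have *: "2 * ennreal a + 2 * ennreal b = ennreal (2 * a + 2 * b)" if "0 \<le> a" "0 \<le> b" for a b
      using that by (simp add: ennreal_mult)
    show ?thesis
      by (rule *) (use e opt_value_nonneg[of x0] opt_value_nonneg[of z0] in simp_all)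
  qed
  finally have "opt_value (x0 + z0) + opt_value (x0 - z0) \<le> 2 * (opt_value x0 + e / 4) + 2 * (opt_value z0 + e / 4)"
    by (rule ennreal_le_iff[THEN iffD1, rotated])
      (use e opt_value_nonneg[of x0] opt_value_nonneg[of z0] in simp)
  then show "opt_value (x0 + z0) + opt_value (x0 - z0) \<le> 2 * opt_value x0 + 2 * opt_value z0 + e"
    by argo
qed

lemma opt_value_scaleC_le: "opt_value (c *\<^sub>C x0) \<le> (cmod c)\<^sup>2 * opt_value x0"
proof (rule field_le_epsilon)
  fix e :: real assume e: "e > 0"
  \<comment> \<open>The slack gets multiplied by \<open>(cmod c)\<^sup>2\<close>; adding 1 to the
    denominator covers \<open>c = 0\<close>.\<close>
  define d where "d = e / ((cmod c)\<^sup>2 + 1)"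
  have d: "d > 0" "(cmod c)\<^sup>2 * d \<le> e"
    using e by (auto simp: d_def field_simps add_pos_nonneg add_nonneg_pos)
  obtain x u y where 1: "generalized_solution D S x u y" "u \<in> L2 {0..}" "x 0 = x0"
    "l2_energy {0..} u + l2_energy {0..} y \<le> ennreal (opt_value x0 + d)"
    using opt_value_approx[OF d(1)] .
  note n = generalized_solution_norm_measurable[OF 1(1)]
  have "ennreal (opt_value (c *\<^sub>C x0)) = optimal_cost D S (c *\<^sub>C x0)"
    by (simp add: optimal_cost_eq)
  also have "\<dots> \<le> l2_energy {0..} (\<lambda>t. c *\<^sub>C u t) + l2_energy {0..} (\<lambda>t. c *\<^sub>C y t)"
    using optimal_cost_le[OF generalized_solution_scaleC[OF 1(1), of c] L2_scaleC[OF _ 1(2)]] 1(3) by simp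
  also have "\<dots> = ennreal ((cmod c)\<^sup>2) * (l2_energy {0..} u + l2_energy {0..} y)"
    by (simp add: l2_energy_scaleC[OF n(1)] l2_energy_scaleC[OF n(2)] distrib_left)
  also have "\<dots> \<le> ennreal ((cmod c)\<^sup>2) * ennreal (opt_value x0 + d)"
    by (intro mult_left_mono 1(4)) auto
  also have "\<dots> = ennreal ((cmod c)\<^sup>2 * (opt_value x0 + d))"
    by (rule ennreal_mult[symmetric]) (use d opt_value_nonneg[of x0] in auto)
  finally have "opt_value (c *\<^sub>C x0) \<le> (cmod c)\<^sup>2 * (opt_value x0 + d)"
    by (rule ennreal_le_iff[THEN iffD1, rotated]) (use d opt_value_nonneg[of x0] in simp)
  then show "opt_value (c *\<^sub>C x0) \<le> (cmod c)\<^sup>2 * opt_value x0 + e"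
    using d(2) by (simp add: distrib_left)
qed

text \<open>The reverse inequality is the scaling estimate for \<open>inverse c\<close> at the
  scaled state.\<close>

lemma opt_value_scaleC: "opt_value (c *\<^sub>C x0) = (cmod c)\<^sup>2 * opt_value x0"
proof (cases "c = 0")
  case True
  then show ?thesis
    using opt_value_scaleC_le[of c x0] opt_value_nonneg[of "c *\<^sub>C x0"] by simp
next
  case False
  have "opt_value x0 = opt_value (inverse c *\<^sub>C (c *\<^sub>C x0))"
    using False scaleC_of_real[of 1 x0] by (simp add: scaleC_scaleC)
  also have "\<dots> \<le> (cmod (inverse c))\<^sup>2 * opt_value (c *\<^sub>C x0)"
    by (rule opt_value_scaleC_le)
  also have "\<dots> = opt_value (c *\<^sub>C x0) / (cmod c)\<^sup>2"
    by (simp add: norm_inverse power_inverse divide_inverse)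
  finally have "(cmod c)\<^sup>2 * opt_value x0 \<le> opt_value (c *\<^sub>C x0)"
    using False by (simp add: pos_le_divide_eq mult.commute)
  then show ?thesis using opt_value_scaleC_le[of c x0] by simp
qed

text \<open>Applied at \<open>x + y\<close> and \<open>x - y\<close>, the inequality already shown
  reverses itself, since their sum and difference are \<open>x + x\<close> and \<open>y + y\<close>,
  with values four times those of \<open>x\<close> and \<open>y\<close>.\<close>

lemma opt_value_parallelogram:
  "opt_value (x + y) + opt_value (x - y) = 2 * opt_value x + 2 * opt_value y"
proof (rule antisym[OF opt_value_parallelogram_le])
  have double: "opt_value (z + z) = 4 * opt_value z" for z
    using opt_value_scaleC[of 2 z] scaleC_of_real[of 2 z] by (simp add: scaleR_2)
  show "2 * opt_value x + 2 * opt_value y \<le> opt_value (x + y) + opt_value (x - y)"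
    using opt_value_parallelogram_le[of "x + y" "x - y"] double[of x] double[of y] by simp
qed

lemma optimal_cost_operator_iff:
  "optimal_cost_operator D S P \<longleftrightarrow>
    selfadjoint P \<and> (\<forall>x0. cinner x0 (P x0) = complex_of_real (opt_value x0))"
  unfolding optimal_cost_operator_def opt_value_def[symmetric]
  by (auto simp: optimal_cost_eq)

lemma optimal_cost_operator_ex1: "\<exists>!P. optimal_cost_operator D S P"
proof -
  obtain P where P: "selfadjoint P" "\<And>x. cinner x (P x) = complex_of_real (opt_value x)"
    using quadratic_form_operator[OF opt_value_parallelogram opt_value_scaleC opt_value_nonneg opt_value_le]
    by blast
  then show ?thesis
    unfolding optimal_cost_operator_iff by (intro ex1I[of _ P]) (auto intro!: selfadjoint_eqI)
qed

text \<open>Subtracting the free trajectory leaves a trajectory from rest, whose norm is bounded by the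
  norm of the input.\<close>

lemma forced_response_le:
  assumes sol: "generalized_solution D S x u y" and \<tau>: "\<tau> > 0"
  shows "norm (x \<tau>) \<le> norm (T \<tau> (x 0)) + l2_norm {0..\<tau>} u"
proof -
  obtain w where w: "generalized_solution D S (\<lambda>t. T t (x 0)) (\<lambda>t. 0) w"
    using free_solution by metis
  have "(norm (x \<tau> - T \<tau> (x 0)))\<^sup>2 \<le> (l2_norm {0..\<tau>} u)\<^sup>2"
    using generalized_energy_le[OF generalized_solution_diff[OF sol w] \<tau>]
    by (simp only: c0_zero[OF c0] diff_self diff_zero norm_zero) (smt (verit) zero_le_power2 zero_power2)
  then have "norm (x \<tau> - T \<tau> (x 0)) \<le> l2_norm {0..\<tau>} u"
    by (rule power2_le_imp_le) simp
  then show ?thesis using norm_triangle_sub[of "x \<tau>" "T \<tau> (x 0)"] by simp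
qed

text \<open>Let \<open>n\<close> be the norm of the free state at \<open>\<tau>\<close> and
  \<open>N\<close> that of the input on \<open>[0, \<tau>]\<close>. In the balance the final state
  costs at most \<open>(n + N)\<^sup>2\<close> and the input contributes \<open>N\<^sup>2\<close>,
  so the loss is at most \<open>n\<^sup>2 + 2 * n * N\<close>. It tends to 0, because
  \<open>N\<close> stays below the norm of the input on the half line.\<close>

lemma output_energy_ge:
  assumes pres: "scattering_energy_preserving D S" and stable: "strongly_stable T"
    and sol: "generalized_solution D S x u y" and u: "u \<in> L2 {0..}"
  shows "ennreal ((norm (x 0))\<^sup>2) \<le> l2_energy {0..} y"
proof -
  let ?n = "\<lambda>\<tau>. norm (T \<tau> (x 0))" and ?U = "l2_norm {0..} u"
  \<comment> \<open>Negative values are truncated to 0 by \<open>ennreal\<close>, which is harmless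
    in a lower bound for an energy.\<close>
  let ?b = "\<lambda>\<tau>. ennreal ((norm (x 0))\<^sup>2 - (?n \<tau>)\<^sup>2 - 2 * ?n \<tau> * ?U)"
  have lim: "(?n \<longlongrightarrow> 0) at_top" using stable by (simp add: strongly_stable_def)
  have "((\<lambda>\<tau>. (norm (x 0))\<^sup>2 - (?n \<tau>)\<^sup>2 - 2 * ?n \<tau> * ?U) \<longlongrightarrow> (norm (x 0))\<^sup>2 - 0\<^sup>2 - 2 * 0 * ?U) at_top"
    by (intro tendsto_intros lim)
  then have "(?b \<longlongrightarrow> ennreal ((norm (x 0))\<^sup>2)) at_top"
    using tendsto_ennrealI by fastforce
  moreover have "\<forall>\<^sub>F \<tau> in at_top. ?b \<tau> \<le> l2_energy {0..} y"
    using eventually_gt_at_top[of 0]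
  proof eventually_elim
    case (elim \<tau>)
    define N where "N = l2_norm {0..\<tau>} u"
    have N: "0 \<le> N" "N \<le> ?U"
    proof -
      show "0 \<le> N" by (simp add: N_def)
      show "N \<le> ?U"
        unfolding N_def l2_norm_def
        using u by (intro real_sqrt_le_mono enn2real_mono l2_energy_mono) (auto simp: L2_iff)
    qed
    have "(norm (x \<tau>))\<^sup>2 \<le> (?n \<tau> + N)\<^sup>2"
      unfolding N_def by (intro power_mono forced_response_le[OF sol elim]) simp
    also have "\<dots> = (?n \<tau>)\<^sup>2 + 2 * ?n \<tau> * N + N\<^sup>2" by (simp add: power2_sum)
    also have "\<dots> \<le> (?n \<tau>)\<^sup>2 + 2 * ?n \<tau> * ?U + N\<^sup>2"
      using N by (intro add_mono mult_left_mono) auto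
    finally have "(norm (x 0))\<^sup>2 - (?n \<tau>)\<^sup>2 - 2 * ?n \<tau> * ?U \<le> (l2_norm {0..\<tau>} y)\<^sup>2"
      using generalized_energy_eq[OF pres sol elim] by (simp add: N_def)
    then have "?b \<tau> \<le> ennreal ((l2_norm {0..\<tau>} y)\<^sup>2)" by (rule ennreal_leI)
    also have "\<dots> = l2_energy {0..\<tau>} y"
      using generalized_solutionD(3)[OF sol elim] by (simp add: L2_iff l2_energy_eq)
    also have "\<dots> \<le> l2_energy {0..} y" by (rule l2_energy_mono) auto
    finally show "?b \<tau> \<le> l2_energy {0..} y" .
  qed
  ultimately show ?thesis by (rule tendsto_upperbound) simp
qed

text \<open>The input energy is kept as a separate surplus over the squared norm of the initial
  state: dropping it gives the value, retaining it gives uniqueness of the optimal input.\<close>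

lemma cost_ge:
  assumes "scattering_energy_preserving D S" "strongly_stable T" "u \<in> L2 {0..}"
  shows "l2_energy {0..} u + ennreal ((norm x0)\<^sup>2) \<le> cost D S x0 u"
  using output_energy_ge[OF assms(1,2) _ assms(3)] by (intro cost_greatest add_left_mono) auto

lemma optimal_cost_eq_norm:
  assumes "scattering_energy_preserving D S" "strongly_stable T"
  shows "optimal_cost D S x0 = ennreal ((norm x0)\<^sup>2)"
proof (rule antisym[OF optimal_cost_le_norm])
  show "ennreal ((norm x0)\<^sup>2) \<le> optimal_cost D S x0"
    unfolding optimal_cost_def
    by (rule INF_greatest, rule order_trans[OF _ cost_ge[OF assms]]) (simp_all add: add_increasing)
qed

lemma zero_optimal:
  assumes "scattering_energy_preserving D S" "strongly_stable T"
  shows "optimal_control D S x0 (\<lambda>t. 0)"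
  using cost_zero_le[of x0] cost_ge[OF assms L2_zero, of x0]
  by (simp add: optimal_control_def optimal_cost_eq_norm[OF assms])

lemma zero_stabilizing:
  assumes "strongly_stable T"
  shows "stabilizing_control D S x0 (\<lambda>t. 0)"
proof -
  obtain w where "generalized_solution D S (\<lambda>t. T t x0) (\<lambda>t. 0) w"
    using free_solution by metis
  then show ?thesis
    using assms c0_zero[OF c0, of x0]
    unfolding stabilizing_control_def strongly_stable_def by blast
qed

text \<open>By \<open>cost_ge\<close> an optimal input has zero energy once the finite squared norm
  of \<open>x0\<close> is cancelled. Inputs are functions and not classes, so uniqueness can hold
  only up to a null set.\<close>

lemma optimal_control_AE_zero:
  assumes "scattering_energy_preserving D S" "strongly_stable T" and opt: "optimal_control D S x0 u"
  shows "AE t in lebesgue_on {0..}. u t = 0"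
proof -
  have u: "u \<in> L2 {0..}" using opt by (simp add: optimal_control_def)
  have "l2_energy {0..} u + ennreal ((norm x0)\<^sup>2) \<le> 0 + ennreal ((norm x0)\<^sup>2)"
    using cost_ge[OF assms(1,2) u, of x0] opt
    by (simp add: optimal_control_def optimal_cost_eq_norm[OF assms(1,2)])
  then have "l2_energy {0..} u = 0"
    using ennreal_add_left_cancel_le[of "ennreal ((norm x0)\<^sup>2)" "l2_energy {0..} u" 0]
    by (simp add: add.commute)
  moreover have [measurable]: "(\<lambda>t. norm (u t)) \<in> borel_measurable (lebesgue_on {0..})"
    using u by (intro strongly_measurable_norm) (auto simp: L2_iff)
  ultimately have "AE t in lebesgue_on {0..}. ennreal ((norm (u t))\<^sup>2) = 0"
    unfolding l2_energy_def by (subst (asm) nn_integral_0_iff_AE) auto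
  then show ?thesis by eventually_elim simp
qed

end

lemma selfadjoint_ident: "selfadjoint (\<lambda>x. x)"
  by (simp add: selfadjoint_def bounded_clinear_def bounded_linear_ident)

lemma (in passive_node) identity_optimal_cost_operator:
  assumes "scattering_energy_preserving D S" "strongly_stable T"
  shows "optimal_cost_operator D S (\<lambda>x. x)"
  by (simp add: optimal_cost_operator_def selfadjoint_ident cinner_self optimal_cost_eq_norm[OF assms])

text \<open>For the identity the two inner products are complex conjugates and sum to the supplied
  power. Adding the squared norms of output and input leaves twice the squared norm of
  \<open>u\<close>, the origin of the factor \<open>sqrt 2\<close>.\<close>

lemma (in linear_node) identity_riccati:
  assumes "scattering_energy_preserving D S"
  shows "operator_node_riccati D S (\<lambda>x. x) (\<lambda>(x, u). sqrt 2 *\<^sub>R u)"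
  unfolding operator_node_riccati_def
proof (intro conjI selfadjoint_ident)
  show "clinear_on D (\<lambda>(x, u). sqrt 2 *\<^sub>R u)"
    using lin
    by (auto simp: clinear_on_def scaleR_add_right scaleC_prod_def
        linear_scale[OF bounded_linear.linear[OF bounded_linear_scaleC]])
  show "\<forall>(x, u)\<in>D. cinner (fst (S (x, u))) x + cinner x (fst (S (x, u)))
          + complex_of_real ((norm (snd (S (x, u))))\<^sup>2) + complex_of_real ((norm u)\<^sup>2)
        = complex_of_real ((norm (case (x, u) of (x, u) \<Rightarrow> sqrt 2 *\<^sub>R u))\<^sup>2)"
  proof clarify
    fix x u assume "(x, u) \<in> D"
    then have e: "2 * Re (cinner (fst (S (x, u))) x) = (norm u)\<^sup>2 - (norm (snd (S (x, u))))\<^sup>2"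
      using assms by (auto simp: scattering_energy_preserving_def)
    have "cinner (fst (S (x, u))) x + cinner x (fst (S (x, u))) = complex_of_real (2 * Re (cinner (fst (S (x, u))) x))"
      using complex_add_cnj[of "cinner (fst (S (x, u))) x"] by (simp flip: cinner_commute)
    also have "\<dots> = complex_of_real ((norm u)\<^sup>2 - (norm (snd (S (x, u))))\<^sup>2)" by (simp only: e)
    finally show "cinner (fst (S (x, u))) x + cinner x (fst (S (x, u)))
          + complex_of_real ((norm (snd (S (x, u))))\<^sup>2) + complex_of_real ((norm u)\<^sup>2)
        = complex_of_real ((norm (sqrt 2 *\<^sub>R u))\<^sup>2)"
      by (simp add: power_mult_distrib)
  qed
qed

theorem theorem3:
  fixes D :: "('x::complex_hilbert \<times> 'u::complex_hilbert) set"
    and S :: "'x \<times> 'u \<Rightarrow> 'x \<times> 'y::complex_hilbert"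
    and T :: "real \<Rightarrow> 'x \<Rightarrow> 'x"
    and l0 :: complex
    and j :: "'x \<Rightarrow> 'w::complex_banach"
  assumes "system_node l0 j D S"
    and "associated_semigroup D S T"
    and "scattering_passive D S"
  shows "finite_cost_condition D S \<and>
    (\<exists>!P. optimal_cost_operator D S P) \<and>
    (\<forall>P. optimal_cost_operator D S P \<longrightarrow> (\<forall>x. Re (cinner x (P x)) \<le> (norm x)\<^sup>2)) \<and>
    (scattering_energy_preserving D S \<and> strongly_stable T \<longrightarrow>
      (\<forall>x0. optimal_control D S x0 (\<lambda>t. 0) \<and> stabilizing_control D S x0 (\<lambda>t. 0) \<and>
        (\<forall>u. optimal_control D S x0 u \<and> stabilizing_control D S x0 u \<longrightarrow>
          (AE t in lebesgue_on {0..}. u t = 0))) \<and>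
      optimal_cost_operator D S (\<lambda>x. x) \<and>
      operator_node_riccati D S (\<lambda>x. x) (\<lambda>(x, u). sqrt 2 *\<^sub>R u))"
proof -
  interpret passive_node D S T
    using assms by unfold_locales (auto simp: system_node_def closed_operator_def)
  have "finite_cost_condition D S"
    unfolding finite_cost_condition_def
    using le_less_trans[OF cost_zero_le] by (metis ennreal_less_top infinity_ennreal_def)
  moreover have "Re (cinner x (P x)) \<le> (norm x)\<^sup>2" if "optimal_cost_operator D S P" for P x
    using that opt_value_le[of x] by (simp add: optimal_cost_operator_iff)
  ultimately show ?thesis
    using optimal_cost_operator_ex1 zero_optimal zero_stabilizing optimal_control_AE_zero
      identity_optimal_cost_operator identity_riccati
    by blast
qed

end
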